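(* Let $m\ge1$, $\mathcal{O}=(0,+\infty)\times\mathbb{R}^m$ with points $x=(x_0,x_1,\dots,x_m)$, and $\lambda>0$. Let $\mathcal{W}$ be a spatially homogeneous Wiener process on $\mathbb{R}^m\cong\partial\mathcal{O}$ with spectral measure $\nu$, and let $u$ be the solution to $\Delta u=\lambda u$ on $\mathcal{O}$, $u=\gamma$ on $\partial\mathcal{O}$, with $\gamma=\mathcal{W}(1)$. Then there is a constant $C$ such that $$\mathbb{E}\,u^2(x)\le C\int_{\mathbb{R}^m}\left(x_0^{-2}\chi_{\{|y|\le1\}}+x_0^{-4}|y|^{-1/m}\chi_{\{|y|>1\}}\right)\nu(\mathrm{d}y),\qquad x\in\mathcal{O}.$$
   Context: Homogeneous Wiener process: $\mathcal{W}$ is a Gaussian process with continuous trajectories in $\mathcal{S}'(\mathbb{R}^m)$ such that for each $\psi\in\mathcal{S}(\mathbb{R}^m)$, $t\mapsto(\mathcal{W}(t),\psi)$ is a one-dimensional Wiener process, with $\mathbb{E}(\mathcal{W}(t),\psi)(\mathcal{W}(s),\varphi)=(t\wedge s)\,Q(\psi,\varphi)$, and the law of $\mathcal{W}(t)$ is invariant under all translations of $\mathbb{R}^m$. Equivalently $Q(\psi,\varphi)=(\Gamma,\psi*\varphi_{(s)})$, $\varphi_{(s)}(x)=\overline{\varphi(-x)}$, where $\Gamma\in\mathcal{S}'(\mathbb{R}^m)$ is the Fourier transform of a positive symmetric tempered measure $\nu$ on $\mathbb{R}^m$ (tempered: $\int(1+|x|)^r\,\mathrm{d}\nu<\infty$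 for some $r<0$); $\nu$ is the spectral measure. Fourier transform: $\mathcal{F}f(y)=\int_{\mathbb{R}^m}e^{i\langle z,y\rangle}f(z)\,\mathrm{d}z$. Solution: the boundary $\partial\mathcal{O}=\{0\}\times\mathbb{R}^m$ is identified with $\mathbb{R}^m$; $\mathbf{n}$ is the inward unit normal. The unique weak solution of the Dirichlet problem is identified inside $\mathcal{O}$ with the smooth random field $$u(x)=\left(\gamma,\frac{\partial\mathcal{G}}{\partial\mathbf{n}_y}(x,\cdot)\Big|_{\partial\mathcal{O}}\right),\qquad\mathcal{G}(x,y)=\int_0^\infty e^{-\lambda t}G(t,x,y)\,\mathrm{d}t,$$ where $G$ is the heat kernel of $\mathcal{O}$ with homogeneous Dirichlet boundary conditions. The right-hand side of the estimate may be infinite. *)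

theory Defs
  imports "HOL-Probability.Probability"
begin

text \<open>Partial derivatives along the standard basis, and the classes \<open>C\<^sup>k\<close>. For a multi-index given as a
  list of basis vectors, \<^term>\<open>bs\<close> lists the directions of differentiation.\<close>

definition partial :: "'a::euclidean_space \<Rightarrow> ('a \<Rightarrow> 'b::real_normed_vector) \<Rightarrow> 'a \<Rightarrow> 'b" where
  "partial b f x = vector_derivative (\<lambda>s. f (x + s *\<^sub>R b)) (at 0)"

fun partials :: "'a::euclidean_space list \<Rightarrow> ('a \<Rightarrow> 'b::real_normed_vector) \<Rightarrow> 'a \<Rightarrow> 'b" where
  "partials [] f = f"
| "partials (b # bs) f = partial b (partials bs f)"

text \<open>Intended for open sets \<^term>\<open>D\<close>.\<close>

definition Ck_on :: "nat \<Rightarrow> 'a::euclidean_space set \<Rightarrow> ('a \<Rightarrow> 'b::real_normed_vector) \<Rightarrow> bool" where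
  "Ck_on k D f \<longleftrightarrow>
     (\<forall>bs. set bs \<subseteq> Basis \<and> length bs < k \<longrightarrow> partials bs f differentiable_on D) \<and>
     (\<forall>bs. set bs \<subseteq> Basis \<and> length bs \<le> k \<longrightarrow> continuous_on D (partials bs f))"

definition laplacian :: "('a::euclidean_space \<Rightarrow> real) \<Rightarrow> 'a \<Rightarrow> real" where
  "laplacian f x = (\<Sum>b\<in>Basis. partial b (partial b f) x)"

definition schwartz :: "('a::euclidean_space \<Rightarrow> 'b::real_normed_vector) set" where
  "schwartz = {f. (\<forall>k. Ck_on k UNIV f) \<and>
     (\<forall>k bs. set bs \<subseteq> Basis \<longrightarrow> bounded (range (\<lambda>x. (1 + norm x) ^ k *\<^sub>R partials bs f x)))}"

definition schwartz_seminorm :: "nat \<Rightarrow> ('a::euclidean_space \<Rightarrow> 'b::real_normed_vector) \<Rightarrow> real" where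
  "schwartz_seminorm k f =
     Sup {(1 + norm x) ^ k * norm (partials bs f x) | x bs. set bs \<subseteq> Basis \<and> length bs \<le> k}"

text \<open>Real tempered distributions. A distribution is represented by a function on all of
  \<^typ>\<open>'a \<Rightarrow> real\<close>, of which only the values on Schwartz functions are meaningful.\<close>

definition tempered_distribution :: "(('a::euclidean_space \<Rightarrow> real) \<Rightarrow> real) \<Rightarrow> bool" where
  "tempered_distribution T \<longleftrightarrow>
     (\<forall>\<psi>\<in>schwartz. \<forall>\<phi>\<in>schwartz. \<forall>a b. T (\<lambda>x. a * \<psi> x + b * \<phi> x) = a * T \<psi> + b * T \<phi>) \<and>
     (\<exists>C k. \<forall>\<psi>\<in>schwartz. \<bar>T \<psi>\<bar> \<le> C * schwartz_seminorm k \<psi>)"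

definition fourier :: "('a::euclidean_space \<Rightarrow> complex) \<Rightarrow> 'a \<Rightarrow> complex" where
  "fourier f y = (LINT z|lborel. exp (\<i> * complex_of_real (z \<bullet> y)) * f z)"

definition convolution :: "('a::euclidean_space \<Rightarrow> complex) \<Rightarrow> ('a \<Rightarrow> complex) \<Rightarrow> 'a \<Rightarrow> complex" where
  "convolution f g x = (LINT z|lborel. f (x - z) * g z)"

definition conj_reflect :: "('a::euclidean_space \<Rightarrow> complex) \<Rightarrow> 'a \<Rightarrow> complex" where
  "conj_reflect f x = cnj (f (- x))"

definition measure_distribution :: "'a::euclidean_space measure \<Rightarrow> ('a \<Rightarrow> complex) \<Rightarrow> complex" where
  "measure_distribution \<nu> \<psi> = (LINT y|\<nu>. \<psi> y)"

definition fourier_distribution ::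
    "(('a::euclidean_space \<Rightarrow> complex) \<Rightarrow> complex) \<Rightarrow> ('a \<Rightarrow> complex) \<Rightarrow> complex" where
  "fourier_distribution T \<psi> = T (fourier \<psi>)"

text \<open>Gaussian laws may be degenerate: \<^term>\<open>v\<close> is the variance and may vanish.\<close>

definition normal_law :: "real \<Rightarrow> real \<Rightarrow> real measure" where
  "normal_law \<mu> v =
     (if v = 0 then return borel \<mu> else density lborel (\<lambda>x. ennreal (normal_density \<mu> (sqrt v) x)))"

definition gaussian_process :: "'w measure \<Rightarrow> 'i set \<Rightarrow> ('i \<Rightarrow> 'w \<Rightarrow> real) \<Rightarrow> bool" where
  "gaussian_process M I X \<longleftrightarrow>
     (\<forall>i\<in>I. X i \<in> borel_measurable M) \<and>
     (\<forall>J c. finite J \<and> J \<subseteq> I \<longrightarrow>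
        (\<exists>\<mu> v. v \<ge> 0 \<and> distr M borel (\<lambda>\<omega>. \<Sum>i\<in>J. c i * X i \<omega>) = normal_law \<mu> v))"

text \<open>One-dimensional Wiener process with variance \<^term>\<open>q\<close> at time \<open>1\<close>; it is standard for \<open>q = 1\<close>.\<close>

definition wiener_process :: "'w measure \<Rightarrow> real \<Rightarrow> (real \<Rightarrow> 'w \<Rightarrow> real) \<Rightarrow> bool" where
  "wiener_process M q B \<longleftrightarrow>
     q \<ge> 0 \<and>
     (\<forall>t\<ge>0. B t \<in> borel_measurable M) \<and>
     (AE \<omega> in M. B 0 \<omega> = 0) \<and>
     (\<forall>\<omega>\<in>space M. continuous_on {0..} (\<lambda>t. B t \<omega>)) \<and>
     (\<forall>s t. 0 \<le> s \<and> s \<le> t \<longrightarrow> distr M borel (\<lambda>\<omega>. B t \<omega> - B s \<omega>) = normal_law 0 (q * (t - s))) \<and>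
     (\<forall>(n::nat) \<tau>. 0 \<le> \<tau> 0 \<and> (\<forall>i<n. \<tau> i \<le> \<tau> (Suc i)) \<longrightarrow>
        prob_space.indep_vars M (\<lambda>_. borel) (\<lambda>i \<omega>. B (\<tau> (Suc i)) \<omega> - B (\<tau> i) \<omega>) {..<n})"

text \<open>Continuity of a trajectory in the space of tempered distributions is stated for the weak-* topology;
  for curves this is the same as for the strong topology. The law of \<^term>\<open>W t\<close> is its law on the
  cylindrical sigma-algebra; a translation acts on a distribution by translating test functions.\<close>

definition homogeneous_wiener_process ::
    "'w measure \<Rightarrow> (real \<Rightarrow> 'w \<Rightarrow> ('a::euclidean_space \<Rightarrow> real) \<Rightarrow> real) \<Rightarrow>
     (('a \<Rightarrow> real) \<Rightarrow> ('a \<Rightarrow> real) \<Rightarrow> real) \<Rightarrow> bool" where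
  "homogeneous_wiener_process M W Q \<longleftrightarrow>
     prob_space M \<and>
     (\<forall>\<omega>\<in>space M. \<forall>t\<ge>0. tempered_distribution (W t \<omega>)) \<and>
     (\<forall>\<omega>\<in>space M. \<forall>\<psi>\<in>schwartz. continuous_on {0..} (\<lambda>t. W t \<omega> \<psi>)) \<and>
     gaussian_process M ({0..} \<times> schwartz) (\<lambda>(t, \<psi>) \<omega>. W t \<omega> \<psi>) \<and>
     (\<forall>\<psi>\<in>schwartz. \<exists>q. wiener_process M q (\<lambda>t \<omega>. W t \<omega> \<psi>)) \<and>
     (\<forall>\<psi>\<in>schwartz. \<forall>\<phi>\<in>schwartz. \<forall>t\<ge>0. \<forall>s\<ge>0.
        prob_space.expectation M (\<lambda>\<omega>. W t \<omega> \<psi> * W s \<omega> \<phi>) = min t s * Q \<psi> \<phi>) \<and>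
     (\<forall>t\<ge>0. \<forall>h.
        distr M (PiM schwartz (\<lambda>_. borel)) (\<lambda>\<omega>. \<lambda>\<psi>\<in>schwartz. W t \<omega> (\<lambda>x. \<psi> (x + h))) =
        distr M (PiM schwartz (\<lambda>_. borel)) (\<lambda>\<omega>. \<lambda>\<psi>\<in>schwartz. W t \<omega> \<psi>))"

definition tempered_measure :: "'a::euclidean_space measure \<Rightarrow> bool" where
  "tempered_measure \<nu> \<longleftrightarrow>
     sets \<nu> = sets borel \<and> (\<exists>r<0. (\<integral>\<^sup>+x. ennreal ((1 + norm x) powr r) \<partial>\<nu>) < \<infinity>)"

definition spectral_measure ::
    "(('a::euclidean_space \<Rightarrow> real) \<Rightarrow> ('a \<Rightarrow> real) \<Rightarrow> real) \<Rightarrow> 'a measure \<Rightarrow> bool" where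
  "spectral_measure Q \<nu> \<longleftrightarrow>
     tempered_measure \<nu> \<and>
     distr \<nu> borel uminus = \<nu> \<and>
     (\<forall>\<psi>\<in>schwartz. \<forall>\<phi>\<in>schwartz.
        complex_of_real (Q \<psi> \<phi>) =
          fourier_distribution (measure_distribution \<nu>)
            (convolution (\<lambda>x. complex_of_real (\<psi> x)) (conj_reflect (\<lambda>x. complex_of_real (\<phi> x)))))"

text \<open>Bounded classical solutions of the heat equation \<open>v\<^sub>t = \<Delta> v\<close> in \<^term>\<open>D\<close> with initial datum
  \<^term>\<open>f\<close> and zero boundary values.\<close>

definition heat_dirichlet_solution ::
    "'a::euclidean_space set \<Rightarrow> ('a \<Rightarrow> real) \<Rightarrow> (real \<Rightarrow> 'a \<Rightarrow> real) \<Rightarrow> bool" where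
  "heat_dirichlet_solution D f v \<longleftrightarrow>
     continuous_on ({0..} \<times> closure D) (\<lambda>(t, x). v t x) \<and>
     bounded ((\<lambda>(t, x). v t x) ` ({0..} \<times> closure D)) \<and>
     (\<forall>t>0. Ck_on 2 D (v t)) \<and>
     (\<forall>t>0. \<forall>x\<in>D. ((\<lambda>s. v s x) has_real_derivative laplacian (v t) x) (at t)) \<and>
     (\<forall>x\<in>closure D. v 0 x = f x) \<and>
     (\<forall>t\<ge>0. \<forall>x\<in>frontier D. v t x = 0)"

text \<open>The Dirichlet heat kernel is the kernel that solves the initial-boundary value problem for all
  bounded continuous initial data compatible with the boundary condition. Bounded solutions being
  unique in a half space, this determines \<^term>\<open>G t x y\<close> for \<open>t > 0\<close>, \<open>x \<in> D\<close>, \<open>y \<in> closure D\<close>.\<close>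

definition dirichlet_heat_kernel ::
    "'a::euclidean_space set \<Rightarrow> (real \<Rightarrow> 'a \<Rightarrow> 'a \<Rightarrow> real) \<Rightarrow> bool" where
  "dirichlet_heat_kernel D G \<longleftrightarrow>
     (\<forall>t>0. \<forall>x\<in>D. continuous_on (closure D) (G t x) \<and> (\<forall>y\<in>frontier D. G t x y = 0)) \<and>
     (\<forall>f. continuous_on (closure D) f \<and> bounded (f ` closure D) \<and> (\<forall>x\<in>frontier D. f x = 0) \<longrightarrow>
        (\<exists>v. heat_dirichlet_solution D f v \<and>
          (\<forall>t>0. \<forall>x\<in>D. set_integrable lborel D (\<lambda>y. G t x y * f y) \<and>
             v t x = (LBINT y:D. G t x y * f y))))"

text \<open>A point of the \<open>(m+1)\<close>-dimensional space is a pair \<open>(x\<^sub>0, x')\<close>.\<close>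

definition half_space :: "(real \<times> (real ^ 'm::finite)) set" where
  "half_space = {0<..} \<times> UNIV"

definition resolvent_kernel :: "real \<Rightarrow> (real \<Rightarrow> 'a \<Rightarrow> 'a \<Rightarrow> real) \<Rightarrow> 'a \<Rightarrow> 'a \<Rightarrow> real" where
  "resolvent_kernel lam G x y = (LBINT t:{0<..}. exp (- lam * t) * G t x y)"

text \<open>The inward normal derivative in the second variable, restricted to the boundary, as a function on
  \<^typ>\<open>real ^ 'm\<close>; it is one-sided since kernels carry information on the closed half space only.\<close>

definition boundary_kernel ::
    "real \<Rightarrow> (real \<Rightarrow> real \<times> (real ^ 'm) \<Rightarrow> real \<times> (real ^ 'm) \<Rightarrow> real) \<Rightarrow>
     real \<times> (real ^ 'm) \<Rightarrow> real ^ 'm \<Rightarrow> real" where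
  "boundary_kernel lam G x y =
     vector_derivative (\<lambda>s. resolvent_kernel lam G x ((0, y) + s *\<^sub>R (1, 0))) (at 0 within {0..})"

definition dirichlet_solution ::
    "real \<Rightarrow> (real \<Rightarrow> real \<times> (real ^ 'm) \<Rightarrow> real \<times> (real ^ 'm) \<Rightarrow> real) \<Rightarrow>
     ((real ^ 'm \<Rightarrow> real) \<Rightarrow> real) \<Rightarrow> real \<times> (real ^ 'm) \<Rightarrow> real" where
  "dirichlet_solution lam G \<gamma> x = \<gamma> (boundary_kernel lam G x)"

end

theory Submission
  imports Defs
begin

text \<open>By the maximum principle, with barrier \<open>\<epsilon> (|x|\<^sup>2 + (2 N + 1) t)\<close> against growth at infinity,
  bounded solutions of the heat equation in the half space are unique. Taking the reflected Gaussian
  \<open>y \<mapsto> K\<^sub>s(y, z)\<close> as initial datum, whose solution is the explicit \<open>K\<^sub>t\<^sub>+\<^sub>s(x, z)\<close>, and letting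
  \<open>s \<rightarrow> 0\<close> identifies the Dirichlet heat kernel with \<open>K\<close>. Hence the boundary kernel at \<open>x = (a, x')\<close> is the
  mixture \<open>P(y) = \<integral> \<rho>(t) H\<^sub>t(y - x') dt\<close> of Gaussians with weight \<open>\<rho>(t) = e\<^sup>-\<^sup>\<lambda>\<^sup>t (a / t) H\<^sub>t(a)\<close>. As \<open>\<rho>\<close> has
  moments of every real order, \<open>P\<close> is a Schwartz function. Therefore \<open>E u(x)\<^sup>2 = Q(P, P) = \<integral> |F P|\<^sup>2 d\<nu>\<close>, where
  \<open>|F P(y)| = \<integral> \<rho>(t) exp(- t |y|\<^sup>2) dt\<close>. The bounds \<open>\<rho>(t) \<le> (4 / a) t\<^sup>-\<^sup>1\<^sup>/\<^sup>2 e\<^sup>-\<^sup>\<lambda>\<^sup>t\<close> and \<open>\<rho>(t) \<le> (C / a\<^sup>2) e\<^sup>-\<^sup>\<lambda>\<^sup>t\<close>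
  give \<open>|F P(y)| \<le> C / a\<close> and \<open>|F P(y)| \<le> C / (a\<^sup>2 |y|\<^sup>2)\<close>, which is more than enough decay.\<close>

subsection \<open>Uniqueness of bounded solutions of the heat equation\<close>

text \<open>The obstacle is how little the hypotheses say about \<open>G\<close>: it represents some
  bounded solution for each admissible initial datum, and nothing is given about its sign, its size
  for large \<open>y\<close> or its differentiability at the boundary. The normal derivative that
  enters \<open>u\<close> is therefore inaccessible until \<open>G\<close> has an explicit formula.
  The formula is extracted from admissible data alone: the solution started from
  \<open>half_space_kernel s y z\<close> is explicit by the semigroup property, and
  \<open>min 1 (fst y)\<close>, admissible as well, supplies the integrable majorant for the limit.
  A second constraint is that \<open>W 1 \<omega>\<close> and \<open>Q\<close> carry meaning only on
  \<open>schwartz\<close>, so decay of all derivatives of the boundary kernel has to be established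
  before any covariance is used. Finally, expectations and spectral integrals in the definitions are
  Bochner integrals, with value 0 for non-integrable functions. On the probability side Gaussianity
  excludes that case; on the spectral side the inequality survives it.\<close>

lemma second_derivative_nonpos_at_max:
  fixes f f' :: "real \<Rightarrow> real"
  assumes d: "d > 0" and f': "\<And>s. \<bar>s\<bar> < d \<Longrightarrow> (f has_real_derivative f' s) (at s)"
    and c: "(f' has_real_derivative c) (at 0)" and max: "\<And>s. \<bar>s\<bar> < d \<Longrightarrow> f s \<le> f 0"
  shows "c \<le> 0"
proof (rule ccontr)
  assume "\<not> c \<le> 0"
  then have "c > 0" by simp
  have z: "f' 0 = 0"
    using DERIV_local_max[of f "f' 0" 0 d] f'[of 0] d max by simp
  obtain e where e: "e > 0" "\<And>h. h > 0 \<Longrightarrow> h < e \<Longrightarrow> f' 0 < f' (0 + h)"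
    using DERIV_pos_inc_right[OF c \<open>c > 0\<close>] by blast
  define h where "h = min d e / 2"
  have h: "h > 0" "h < d" "h < e" using d e(1) by (auto simp: h_def min_def)
  have "f 0 < f h"
  proof (rule DERIV_pos_imp_increasing_open[OF h(1)])
    fix s assume "0 < s" "s < h"
    then have s: "\<bar>s\<bar> < d" "0 < s" "s < e" using h by linarith+
    have "0 < f' s" using e(2)[OF s(2,3)] unfolding z by simp
    with f'[OF s(1)] show "\<exists>y. (f has_real_derivative y) (at s) \<and> 0 < y"
      by blast
  next
    show "continuous_on {0..h} f"
    proof (rule DERIV_continuous_on[where D=f'])
      fix s assume "s \<in> {0..h}"
      then show "(f has_real_derivative f' s) (at s within {0..h})"
        by (intro has_field_derivative_at_within[OF f']) (use h in auto)
    qed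
  qed
  with max[of h] h show False by simp
qed

text \<open>\<open>partial\<close> is a \<open>vector_derivative\<close>, hence an arbitrary value
  where no derivative exists. Total differentiability identifies it with the actual derivative along
  the line, at any parameter \<open>s\<close>.\<close>

lemma has_real_derivative_partial:
  fixes f :: "'a::euclidean_space \<Rightarrow> real"
  assumes "f differentiable (at (x + s *\<^sub>R b))"
  shows "((\<lambda>s. f (x + s *\<^sub>R b)) has_real_derivative partial b f (x + s *\<^sub>R b)) (at s)"
proof -
  have line: "((\<lambda>r. y + r *\<^sub>R b) has_derivative (\<lambda>h. h *\<^sub>R b)) (at r)" for y and r :: real
    by (auto intro!: derivative_eq_intros)
  obtain D where D: "(f has_derivative D) (at (x + s *\<^sub>R b))"
    using assms by (auto simp: differentiable_def)
  interpret D: bounded_linear D by (rule has_derivative_bounded_linear[OF D])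
  have gen: "((\<lambda>r. f (y + r *\<^sub>R b)) has_vector_derivative D b) (at r)"
    if "y + r *\<^sub>R b = x + s *\<^sub>R b" for y r
    using has_derivative_compose[OF line[of y r], of f D] D that
    by (simp add: has_vector_derivative_def D.scaleR)
  have "partial b f (x + s *\<^sub>R b) = D b"
    unfolding partial_def by (rule vector_derivative_at, rule gen) simp
  with gen[of x s] show ?thesis
    by (simp add: has_real_derivative_iff_has_vector_derivative)
qed

lemma partial_eq:
  fixes f :: "'a::euclidean_space \<Rightarrow> real"
  assumes "(f has_derivative D) (at x)"
  shows "partial b f x = D b"
proof -
  interpret D: bounded_linear D by (rule has_derivative_bounded_linear[OF assms])
  have "((\<lambda>r. x + r *\<^sub>R b) has_derivative (\<lambda>h. h *\<^sub>R b)) (at (0::real))"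
    by (auto intro!: derivative_eq_intros)
  from has_derivative_compose[OF this, of f D] assms show ?thesis
    unfolding partial_def
    by (intro vector_derivative_at) (simp add: has_vector_derivative_def D.scaleR)
qed

lemma heat_dirichlet_solution_bounded:
  assumes "heat_dirichlet_solution D f v"
  obtains B where "\<And>t x. t \<ge> 0 \<Longrightarrow> x \<in> closure D \<Longrightarrow> \<bar>v t x\<bar> \<le> B"
proof -
  have "bounded ((\<lambda>(t, x). v t x) ` ({0..} \<times> closure D))"
    using assms by (simp add: heat_dirichlet_solution_def)
  then obtain B where B: "\<And>p. p \<in> {0..} \<times> closure D \<Longrightarrow> norm (case p of (t, x) \<Rightarrow> v t x) \<le> B"
    unfolding bounded_iff by blast
  show thesis
    by (rule that[of B]) (use B in force)
qed

text \<open>If \<open>v1 > v2\<close> somewhere, subtracting the barrier leaves a function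
  \<open>w\<close> with a positive maximum over a compact cylinder. The initial values, the zero
  boundary values and the size of the barrier on the sphere of radius \<open>R\<close> keep the
  maximum off the bottom and the sides. There the time derivative of \<open>w\<close> is nonnegative
  while its pure second derivatives are nonpositive. Up to the factor \<open>\<epsilon>\<close>, the
  barrier grows at rate 2N + 1 in time but has Laplacian 2N, so the two are incompatible.\<close>

lemma heat_dirichlet_solution_le:
  fixes D :: "'a::euclidean_space set"
  assumes D: "open D" and v1: "heat_dirichlet_solution D f v1" and v2: "heat_dirichlet_solution D f v2"
    and t: "t \<ge> 0" and x: "x \<in> closure D"
  shows "v1 t x \<le> v2 t x"
proof (rule ccontr)
  assume less: "\<not> v1 t x \<le> v2 t x"
  have cont: "continuous_on ({0..} \<times> closure D) (\<lambda>(t, x). v t x)"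
    and Ck: "\<And>t. t > 0 \<Longrightarrow> Ck_on 2 D (v t)"
    and init: "\<And>x. x \<in> closure D \<Longrightarrow> v 0 x = f x"
    and bdry: "\<And>t x. t \<ge> 0 \<Longrightarrow> x \<in> frontier D \<Longrightarrow> v t x = 0"
    if "heat_dirichlet_solution D f v" for v
    using that unfolding heat_dirichlet_solution_def by blast+
  define N where "N = real DIM('a)"
  obtain B1 where B1: "\<And>t x. t \<ge> 0 \<Longrightarrow> x \<in> closure D \<Longrightarrow> \<bar>v1 t x\<bar> \<le> B1"
    using heat_dirichlet_solution_bounded[OF v1] by blast
  obtain B2 where B2: "\<And>t x. t \<ge> 0 \<Longrightarrow> x \<in> closure D \<Longrightarrow> \<bar>v2 t x\<bar> \<le> B2"
    using heat_dirichlet_solution_bounded[OF v2] by blast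
  define \<delta> where "\<delta> = v1 t x - v2 t x"
  have \<delta>: "\<delta> > 0" using less by (simp add: \<delta>_def)
  \<comment> \<open>Makes the barrier at \<open>(t, x)\<close> at most half of the gap
    \<open>\<delta>\<close>, so that \<open>w t x\<close> stays positive.\<close>
  define \<epsilon> where "\<epsilon> = \<delta> / (2 * ((norm x)\<^sup>2 + (2 * N + 1) * t + 1))"
  have den: "(norm x)\<^sup>2 + (2 * N + 1) * t + 1 > 0" using t by (simp add: N_def add_nonneg_pos)
  have \<epsilon>: "\<epsilon> > 0" using \<delta> den by (simp add: \<epsilon>_def)
  define w where "w = (\<lambda>s y. v1 s y - v2 s y - \<epsilon> * ((norm y)\<^sup>2 + (2 * N + 1) * s))"
  have wpos: "w t x > 0"
  proof -
    have "\<epsilon> * ((norm x)\<^sup>2 + (2 * N + 1) * t) \<le> \<epsilon> * ((norm x)\<^sup>2 + (2 * N + 1) * t + 1)"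
      using \<epsilon> by (intro mult_left_mono) auto
    also have "\<dots> = \<delta> / 2" using den by (simp add: \<epsilon>_def field_simps)
    finally show ?thesis using \<delta> by (simp add: w_def \<delta>_def)
  qed
  \<comment> \<open>On the sphere \<open>norm y = R\<close> the term
    \<open>\<epsilon> * (norm y)\<^sup>2\<close> dominates every possible value of
    \<open>v1 - v2\<close>; the maximum with \<open>norm x\<close> keeps \<open>(t, x)\<close>
    inside the cylinder.\<close>
  define R where "R = max (norm x) (sqrt ((B1 + B2) / \<epsilon>) + 1)"
  have B: "B1 + B2 \<ge> 0" using B1[OF t x] B2[OF t x] by linarith
  have wR: "w s y \<le> 0" if "s \<ge> 0" "y \<in> closure D" "norm y = R" for s y
  proof -
    have "(B1 + B2) / \<epsilon> = (sqrt ((B1 + B2) / \<epsilon>))\<^sup>2" using B \<epsilon> by simp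
    also have "\<dots> \<le> (norm y)\<^sup>2" unfolding that(3) R_def using B \<epsilon> by (intro power_mono) auto
    finally have "B1 + B2 \<le> \<epsilon> * (norm y)\<^sup>2" using \<epsilon> by (simp add: field_simps)
    moreover have "\<epsilon> * ((2 * N + 1) * s) \<ge> 0" using \<epsilon> that(1) by (simp add: N_def)
    ultimately show ?thesis using B1[OF that(1,2)] B2[OF that(1,2)]
      by (simp add: w_def distrib_left abs_le_iff)
  qed
  define K where "K = {0..t} \<times> (closure D \<inter> cball 0 R)"
  have "compact K" unfolding K_def by (intro compact_Times closed_Int_compact) auto
  moreover have K: "(t, x) \<in> K" using t x by (auto simp: K_def R_def)
  moreover have "continuous_on K (\<lambda>(s, y). w s y)"
  proof -
    have "continuous_on K (\<lambda>p. (case p of (s, y) \<Rightarrow> v1 s y) - (case p of (s, y) \<Rightarrow> v2 s y)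
       - \<epsilon> * ((norm (snd p))\<^sup>2 + (2 * N + 1) * fst p))"
      by (intro continuous_intros continuous_on_subset[OF cont[OF v1]] continuous_on_subset[OF cont[OF v2]])
        (auto simp: K_def)
    then show ?thesis by (simp add: w_def case_prod_beta)
  qed
  ultimately obtain p where p: "p \<in> K" "\<And>q. q \<in> K \<Longrightarrow> (\<lambda>(s, y). w s y) q \<le> (\<lambda>(s, y). w s y) p"
    using continuous_attains_sup[of K "\<lambda>(s, y). w s y"] by blast
  obtain s y where sy: "p = (s, y)" by (cases p)
  have s: "0 \<le> s" "s \<le> t" and y: "y \<in> closure D" "norm y \<le> R"
    using p(1) by (auto simp: K_def sy)
  have max: "w s' y' \<le> w s y" if "0 \<le> s'" "s' \<le> t" "y' \<in> closure D" "norm y' \<le> R" for s' y'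
    using p(2)[of "(s', y')"] that by (auto simp: K_def sy)
  have pos: "w s y > 0" using max[of t x] wpos K by (auto simp: K_def)
  have R: "norm y < R" using wR[OF s(1) y(1)] pos y(2) by linarith
  have s0: "s > 0"
  proof (rule ccontr)
    assume "\<not> s > 0"
    then have "s = 0" using s by simp
    then have "v1 s y = v2 s y" using init[OF v1 y(1)] init[OF v2 y(1)] by simp
    then show False using pos \<epsilon> s \<open>s = 0\<close> by (simp add: w_def mult_less_0_iff not_less)
  qed
  have yD: "y \<in> D"
  proof (rule ccontr)
    assume "y \<notin> D"
    then have "y \<in> frontier D" using D y by (simp add: frontier_def interior_open)
    then have "v1 s y = v2 s y" using bdry[OF v1 s(1)] bdry[OF v2 s(1)] by simp
    moreover have "\<epsilon> * ((norm y)\<^sup>2 + (2 * N + 1) * s) \<ge> 0" using \<epsilon> s by (simp add: N_def)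
    ultimately show False using pos by (simp add: w_def)
  qed
  define L1 where "L1 = laplacian (v1 s) y"
  define L2 where "L2 = laplacian (v2 s) y"
  have "((\<lambda>r. w r y) has_real_derivative L1 - L2 - \<epsilon> * (2 * N + 1)) (at s)"
  proof -
    have "((\<lambda>r. v r y) has_real_derivative laplacian (v s) y) (at s)"
      if "heat_dirichlet_solution D f v" for v
      using that s0 yD unfolding heat_dirichlet_solution_def by blast
    from this[OF v1] this[OF v2] show ?thesis
      unfolding w_def L1_def L2_def by (auto intro!: derivative_eq_intros)
  qed
  \<comment> \<open>The maximum may sit at the final time \<open>s = t\<close>, so it is compared
    with earlier times only; this already excludes a negative derivative.\<close>
  moreover have "\<not> L1 - L2 - \<epsilon> * (2 * N + 1) < 0"
  proof
    assume "L1 - L2 - \<epsilon> * (2 * N + 1) < 0"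
    with calculation obtain e where e: "e > 0" "\<And>h. h > 0 \<Longrightarrow> h < e \<Longrightarrow> w s y < w (s - h) y"
      using DERIV_neg_dec_left by blast
    define h where "h = min e s / 2"
    have "h > 0" "h < e" "h < s" using e(1) s0 by (auto simp: h_def min_def)
    with e(2)[of h] max[of "s - h" y] s y show False by auto
  qed
  ultimately have time: "L1 - L2 \<ge> \<epsilon> * (2 * N + 1)" by simp
  \<comment> \<open>Each coordinate direction is treated separately: restricted to the line through
    \<open>y\<close>, the function \<open>w s\<close> has a local maximum, and the barrier
    contributes \<open>2 * \<epsilon>\<close>.\<close>
  have "partial b (partial b (v1 s)) y - partial b (partial b (v2 s)) y - 2 * \<epsilon> \<le> 0"
    if b: "b \<in> Basis" for b
  proof -
    have nb: "norm b = 1" using b by simp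
    obtain r where r: "r > 0" "ball y r \<subseteq> D" using D yD by (meson open_contains_ball)
    define d where "d = min r (R - norm y)"
    have d: "d > 0" using r R by (simp add: d_def)
    have inD: "y + q *\<^sub>R b \<in> D" "norm (y + q *\<^sub>R b) \<le> R" if "\<bar>q\<bar> < d" for q
    proof -
      show "y + q *\<^sub>R b \<in> D" using that r(2) nb by (intro subsetD[OF r(2)]) (auto simp: d_def dist_norm)
      show "norm (y + q *\<^sub>R b) \<le> R"
        using norm_triangle_ineq[of y "q *\<^sub>R b"] that nb by (simp add: d_def)
    qed
    have diff: "v s differentiable (at z)" "partial b (v s) differentiable (at z)"
      if v: "heat_dirichlet_solution D f v" and z: "z \<in> D" for v z
    proof -
      have "set bs \<subseteq> Basis \<and> length bs < 2 \<Longrightarrow> partials bs (v s) differentiable_on D" for bs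
        using Ck[OF v s0] unfolding Ck_on_def by blast
      from this[of "[]"] this[of "[b]"] b
      have "v s differentiable_on D" "partial b (v s) differentiable_on D" by simp_all
      then show "v s differentiable (at z)" "partial b (v s) differentiable (at z)"
        using z D by (auto simp: differentiable_on_eq_differentiable_at)
    qed
    show ?thesis
    proof (rule second_derivative_nonpos_at_max[OF d,
        where f = "\<lambda>q. w s (y + q *\<^sub>R b)" and
         f' = "\<lambda>q. partial b (v1 s) (y + q *\<^sub>R b) - partial b (v2 s) (y + q *\<^sub>R b)
           - \<epsilon> * (2 * (b \<bullet> (y + q *\<^sub>R b)))"])
      fix q :: real assume q: "\<bar>q\<bar> < d"
      show "((\<lambda>q. w s (y + q *\<^sub>R b)) has_real_derivative
          partial b (v1 s) (y + q *\<^sub>R b) - partial b (v2 s) (y + q *\<^sub>R b)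
           - \<epsilon> * (2 * (b \<bullet> (y + q *\<^sub>R b)))) (at q)"
      proof -
        have "((\<lambda>q. (norm y)\<^sup>2 + 2 * q * (y \<bullet> b) + q\<^sup>2) has_real_derivative 2 * (b \<bullet> (y + q *\<^sub>R b))) (at q)"
          using b by (auto intro!: derivative_eq_intros simp: inner_commute algebra_simps)
        also have "(\<lambda>q. (norm y)\<^sup>2 + 2 * q * (y \<bullet> b) + q\<^sup>2) = (\<lambda>q. (norm (y + q *\<^sub>R b))\<^sup>2)"
          unfolding power2_norm_eq_inner inner_add_left inner_add_right
          using b by (simp add: fun_eq_iff inner_commute power2_eq_square)
        finally have n: "((\<lambda>q. (norm (y + q *\<^sub>R b))\<^sup>2) has_real_derivative 2 * (b \<bullet> (y + q *\<^sub>R b))) (at q)" .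
        have "((\<lambda>q. \<epsilon> * ((norm (y + q *\<^sub>R b))\<^sup>2 + (2 * N + 1) * s)) has_real_derivative
            \<epsilon> * (2 * (b \<bullet> (y + q *\<^sub>R b)) + 0)) (at q)"
          by (intro DERIV_cmult DERIV_add n DERIV_const)
        then show ?thesis
          unfolding w_def
          by (intro DERIV_diff has_real_derivative_partial diff(1)[OF v1] diff(1)[OF v2] inD(1) q) simp
      qed
      show "w s (y + q *\<^sub>R b) \<le> w s (y + 0 *\<^sub>R b)"
        using max[of s] s inD[OF q] closure_subset by auto
    next
      have *: "((\<lambda>q. v (y + q *\<^sub>R b)) has_real_derivative partial b v y) (at 0)"
        if "v differentiable (at y)" for v
        using has_real_derivative_partial[of v y 0 b] that by simp
      show "((\<lambda>q. partial b (v1 s) (y + q *\<^sub>R b) - partial b (v2 s) (y + q *\<^sub>R b)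
           - \<epsilon> * (2 * (b \<bullet> (y + q *\<^sub>R b)))) has_real_derivative
         partial b (partial b (v1 s)) y - partial b (partial b (v2 s)) y - 2 * \<epsilon>) (at 0)"
      proof -
        have "((\<lambda>q. \<epsilon> * (2 * (b \<bullet> y + q))) has_real_derivative 2 * \<epsilon>) (at 0)"
          by (auto intro!: derivative_eq_intros)
        then have "((\<lambda>q. \<epsilon> * (2 * (b \<bullet> (y + q *\<^sub>R b)))) has_real_derivative 2 * \<epsilon>) (at 0)"
          using b by (simp add: inner_add_right)
        then show ?thesis
          by (intro DERIV_diff * diff(2)[OF v1] diff(2)[OF v2] yD)
      qed
    qed
  qed
  then have "(\<Sum>b\<in>Basis. partial b (partial b (v1 s)) y - partial b (partial b (v2 s)) y - 2 * \<epsilon>) \<le> 0"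
    by (intro sum_nonpos) auto
  then have "L1 - L2 \<le> 2 * \<epsilon> * N"
    by (simp add: L1_def L2_def laplacian_def sum_subtractf N_def mult.commute)
  with time \<epsilon> show False by (simp add: algebra_simps)
qed

lemma heat_dirichlet_solution_unique:
  fixes D :: "'a::euclidean_space set"
  assumes "open D" "heat_dirichlet_solution D f v1" "heat_dirichlet_solution D f v2" "t \<ge> 0" "x \<in> closure D"
  shows "v1 t x = v2 t x"
  using heat_dirichlet_solution_le[OF assms] heat_dirichlet_solution_le[OF assms(1,3,2,4,5)] by simp

subsection \<open>The Gaussian heat kernel\<close>

text \<open>Normalized for v_t = Laplacian v, without a factor 1/2: the marginals are centred normal
  with variance 2t. The dimension is that of the argument type, so the same constant denotes the
  kernel of the whole space, of the boundary and of the real line.\<close>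

definition heat_kernel :: "real \<Rightarrow> 'a::euclidean_space \<Rightarrow> real" where
  "heat_kernel t x = (4 * pi * t) powr (- real DIM('a) / 2) * exp (- (norm x)\<^sup>2 / (4 * t))"

lemma heat_kernel_nonneg: "0 \<le> heat_kernel t x"
  by (simp add: heat_kernel_def)

lemma heat_kernel_minus [simp]: "heat_kernel t (- x) = heat_kernel t x"
  by (simp add: heat_kernel_def)

lemma heat_kernel_le:
  fixes x :: "'a::euclidean_space"
  assumes "0 < s" "s \<le> t"
  shows "heat_kernel t x \<le> (4 * pi * s) powr (- real DIM('a) / 2)"
proof -
  have "heat_kernel t x \<le> (4 * pi * t) powr (- real DIM('a) / 2) * 1"
    unfolding heat_kernel_def using assms by (intro mult_left_mono) auto
  also have "\<dots> \<le> (4 * pi * s) powr (- real DIM('a) / 2)"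
    using assms by (auto intro!: powr_mono2')
  finally show ?thesis .
qed

lemma heat_kernel_prod:
  fixes x :: "'a::euclidean_space"
  assumes "t > 0"
  shows "heat_kernel t x = (\<Prod>b\<in>Basis. normal_density 0 (sqrt (2 * t)) (x \<bullet> b))"
proof -
  have n: "normal_density 0 (sqrt (2 * t)) r = (4 * pi * t) powr (- 1 / 2) * exp (- r\<^sup>2 / (4 * t))" for r
    using assms by (simp add: normal_density_def powr_minus powr_half_sqrt field_simps)
  have "(norm x)\<^sup>2 = (\<Sum>b\<in>Basis. (x \<bullet> b)\<^sup>2)"
    unfolding power2_norm_eq_inner by (subst euclidean_inner) (simp add: power2_eq_square)
  then have "exp (- (norm x)\<^sup>2 / (4 * t)) = (\<Prod>b\<in>Basis. exp (- (x \<bullet> b)\<^sup>2 / (4 * t)))"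
    by (simp add: exp_sum[symmetric] sum_negf sum_divide_distrib)
  moreover have "(4 * pi * t) powr (- real DIM('a) / 2) = ((4 * pi * t) powr (- 1 / 2)) ^ DIM('a)"
    using assms by (subst powr_power) (auto simp: mult.commute)
  ultimately show ?thesis
    unfolding n by (simp add: heat_kernel_def prod.distrib)
qed

text \<open>At a boundary point the kernel splits into a factor in the distance to the boundary,
  which goes into the mixing weight, and a Gaussian along the boundary.\<close>

lemma heat_kernel_Pair:
  fixes a :: real and y :: "'a::euclidean_space"
  assumes "t > 0"
  shows "heat_kernel t (a, y) = heat_kernel t a * heat_kernel t y"
proof -
  have "(4 * pi * t) powr (- real (Suc DIM('a)) / 2) =
    (4 * pi * t) powr (- 1 / 2) * (4 * pi * t) powr (- real DIM('a) / 2)"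
    unfolding powr_add[symmetric] by (simp add: field_simps)
  moreover have "exp (- (norm (a, y))\<^sup>2 / (4 * t)) = exp (- (norm a)\<^sup>2 / (4 * t)) * exp (- (norm y)\<^sup>2 / (4 * t))"
    unfolding exp_add[symmetric] by (simp add: norm_Pair diff_divide_distrib)
  ultimately show ?thesis by (simp add: heat_kernel_def)
qed

lemma has_derivative_heat_kernel:
  assumes "t > 0"
  shows "(heat_kernel t has_derivative (\<lambda>h. - (x \<bullet> h) / (2 * t) * heat_kernel t x)) (at x)"
  unfolding heat_kernel_def power2_norm_eq_inner using assms
  by (auto intro!: derivative_eq_intros simp: fun_eq_iff inner_commute field_simps)

lemma has_real_derivative_heat_kernel_time:
  fixes x :: "'a::euclidean_space"
  assumes "t > 0"
  shows "((\<lambda>t. heat_kernel t x) has_real_derivative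
    (- real DIM('a) / (2 * t) + (norm x)\<^sup>2 / (4 * t\<^sup>2)) * heat_kernel t x) (at t)"
proof -
  define c where "c = - real DIM('a) / 2"
  have "((\<lambda>t. (4 * pi * t) powr c) has_real_derivative c / t * (4 * pi * t) powr c) (at t)"
    using assms by (auto intro!: derivative_eq_intros simp: powr_diff)
  moreover have "((\<lambda>t. exp (- (norm x)\<^sup>2 / (4 * t))) has_real_derivative
      (norm x)\<^sup>2 / (4 * t\<^sup>2) * exp (- (norm x)\<^sup>2 / (4 * t))) (at t)"
    using assms by (auto intro!: derivative_eq_intros simp: power2_eq_square field_simps)
  ultimately have "((\<lambda>t. (4 * pi * t) powr c * exp (- (norm x)\<^sup>2 / (4 * t))) has_real_derivative
     (c / t * (4 * pi * t) powr c) * exp (- (norm x)\<^sup>2 / (4 * t)) +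
     (norm x)\<^sup>2 / (4 * t\<^sup>2) * exp (- (norm x)\<^sup>2 / (4 * t)) * (4 * pi * t) powr c) (at t)"
    by (rule DERIV_mult)
  then show ?thesis
    by (simp add: heat_kernel_def c_def algebra_simps)
qed

lemma continuous_on_heat_kernel [continuous_intros]:
  assumes "continuous_on A f" "continuous_on A g" "\<And>x. x \<in> A \<Longrightarrow> f x > 0"
  shows "continuous_on A (\<lambda>x. heat_kernel (f x) (g x))"
  unfolding heat_kernel_def using assms
  by (intro continuous_intros) (auto simp: less_imp_neq[symmetric])

lemma borel_measurable_heat_kernel [measurable]:
  assumes [measurable]: "f \<in> borel_measurable M" "g \<in> borel_measurable M"
  shows "(\<lambda>x. heat_kernel (f x) (g x)) \<in> borel_measurable M"
  unfolding heat_kernel_def by measurable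

section \<open>Product integrals and the Fourier transform of the Gaussian\<close>

lemma
  fixes f :: "'a::euclidean_space \<Rightarrow> real \<Rightarrow> 'b::{real_normed_field, banach, second_countable_topology}"
  assumes f: "\<And>b. b \<in> Basis \<Longrightarrow> integrable lborel (f b)"
  shows integrable_lborel_prod: "integrable lborel (\<lambda>x::'a. \<Prod>b\<in>Basis. f b (x \<bullet> b))"
    and integral_lborel_prod: "(LINT x::'a|lborel. (\<Prod>b\<in>Basis. f b (x \<bullet> b))) = (\<Prod>b\<in>Basis. LINT r|lborel. f b r)"
proof -
  interpret product_sigma_finite "\<lambda>_::'a. lborel :: real measure" ..
  have [measurable]: "f b \<in> borel_measurable borel" if "b \<in> Basis" for b
    using f[OF that] by (auto dest: borel_measurable_integrable)
  have m: "(\<lambda>x::'a. \<Prod>b\<in>Basis. f b (x \<bullet> b)) \<in> borel_measurable borel"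
    by (intro borel_measurable_prod) measurable
  have [measurable]: "(\<lambda>g. \<Sum>b\<in>Basis. g b *\<^sub>R b) \<in> (\<Pi>\<^sub>M b\<in>(Basis :: 'a set). lborel) \<rightarrow>\<^sub>M borel"
    by measurable
  show "integrable lborel (\<lambda>x::'a. \<Prod>b\<in>Basis. f b (x \<bullet> b))"
    using product_integrable_prod[of Basis f] f m
    by (subst lborel_eq) (simp add: integrable_distr_eq)
  show "(LINT x::'a|lborel. (\<Prod>b\<in>Basis. f b (x \<bullet> b))) = (\<Prod>b\<in>Basis. LINT r|lborel. f b r)"
    using product_integral_prod[of Basis f] f m
    by (subst lborel_eq) (simp add: integral_distr)
qed

text \<open>Substituting \<open>\<sigma> * r\<close> for \<open>r\<close> reduces this to the
  characteristic function of the standard normal law.\<close>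

lemma char_normal_density:
  assumes "\<sigma> > 0"
  shows "integrable lborel (\<lambda>r. exp (\<i> * complex_of_real (r * y)) * complex_of_real (normal_density 0 \<sigma> r))"
    and "(LINT r|lborel. exp (\<i> * complex_of_real (r * y)) * complex_of_real (normal_density 0 \<sigma> r))
      = exp (- complex_of_real (\<sigma>\<^sup>2 * y\<^sup>2 / 2))"
proof -
  show "integrable lborel (\<lambda>r. exp (\<i> * complex_of_real (r * y)) * complex_of_real (normal_density 0 \<sigma> r))"
  proof (rule Bochner_Integration.integrable_bound)
    show "integrable lborel (normal_density 0 \<sigma>)" using assms by (rule integrable_normal_density)
  qed (use assms in \<open>auto simp: norm_mult\<close>)
  have "exp (- complex_of_real (\<sigma>\<^sup>2 * y\<^sup>2 / 2)) = char std_normal_distribution (\<sigma> * y)"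
    by (simp add: char_std_normal_distribution power_mult_distrib exp_of_real[symmetric])
  also have "\<dots> = (LINT r|lborel. std_normal_density r *\<^sub>R iexp (\<sigma> * y * r))"
    by (simp add: char_def integral_density normal_density_nonneg)
  also have "\<dots> = \<bar>\<sigma>\<bar> *\<^sub>R (LINT r|lborel. exp (\<i> * complex_of_real ((0 + \<sigma> * r) * y))
       * complex_of_real (normal_density 0 \<sigma> (0 + \<sigma> * r)))"
  proof -
    have n: "std_normal_density r = \<sigma> * normal_density 0 \<sigma> (0 + \<sigma> * r)" for r
      using assms by (simp add: normal_density_def power_mult_distrib real_sqrt_mult)
    have "std_normal_density r *\<^sub>R iexp (\<sigma> * y * r) = \<bar>\<sigma>\<bar> *\<^sub>R (exp (\<i> * complex_of_real ((0 + \<sigma> * r) * y))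
       * complex_of_real (normal_density 0 \<sigma> (0 + \<sigma> * r)))" for r
      unfolding n using assms by (simp add: scaleR_conv_of_real mult_ac)
    then show ?thesis
      by (simp only: integral_scaleR_right)
  qed
  also have "\<dots> = (LINT r|lborel. exp (\<i> * complex_of_real (r * y)) * complex_of_real (normal_density 0 \<sigma> r))"
    using assms by (intro lborel_integral_real_affine[symmetric]) auto
  finally show "(LINT r|lborel. exp (\<i> * complex_of_real (r * y)) * complex_of_real (normal_density 0 \<sigma> r))
      = exp (- complex_of_real (\<sigma>\<^sup>2 * y\<^sup>2 / 2))" by simp
qed

lemma
  fixes y :: "'a::euclidean_space"
  assumes "t > 0"
  shows fourier_heat_kernel: "fourier (\<lambda>x. complex_of_real (heat_kernel t x)) y = exp (- complex_of_real (t * (norm y)\<^sup>2))"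
    and integrable_fourier_heat_kernel:
      "integrable lborel (\<lambda>x. exp (\<i> * complex_of_real (x \<bullet> y)) * complex_of_real (heat_kernel t x))"
proof -
  define f where "f b r = exp (\<i> * complex_of_real (r * (y \<bullet> b))) * complex_of_real (normal_density 0 (sqrt (2 * t)) r)"
    for b :: 'a and r :: real
  have s: "sqrt (2 * t) > 0" using assms by simp
  have eq: "exp (\<i> * complex_of_real (x \<bullet> y)) * complex_of_real (heat_kernel t x) = (\<Prod>b\<in>Basis. f b (x \<bullet> b))" for x
    unfolding f_def prod.distrib heat_kernel_prod[OF assms] of_real_prod[symmetric]
    by (subst exp_sum[symmetric]) (simp_all add: euclidean_inner[of x y] sum_distrib_left)
  show "integrable lborel (\<lambda>x. exp (\<i> * complex_of_real (x \<bullet> y)) * complex_of_real (heat_kernel t x))"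
    unfolding eq using char_normal_density(1)[OF s] by (intro integrable_lborel_prod) (simp add: f_def)
  have "fourier (\<lambda>x. complex_of_real (heat_kernel t x)) y = (\<Prod>b\<in>Basis. LINT r|lborel. f b r)"
    unfolding fourier_def eq using char_normal_density(1)[OF s] by (intro integral_lborel_prod) (simp add: f_def)
  also have "\<dots> = exp (- complex_of_real (t * (norm y)\<^sup>2))"
  proof -
    have n: "t * (norm y)\<^sup>2 = (\<Sum>b\<in>Basis. t * (y \<bullet> b)\<^sup>2)"
      unfolding power2_norm_eq_inner by (subst euclidean_inner) (simp add: sum_distrib_left power2_eq_square)
    show ?thesis
      unfolding f_def char_normal_density(2)[OF s] n using assms
      by (subst exp_sum[symmetric]) (simp_all add: sum_negf)
  qed
  finally show "fourier (\<lambda>x. complex_of_real (heat_kernel t x)) y = exp (- complex_of_real (t * (norm y)\<^sup>2))" .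
qed

text \<open>Both facts are the Fourier computation at frequency 0.\<close>

lemma
  assumes "t > 0"
  shows integrable_heat_kernel: "integrable lborel (heat_kernel t :: 'a::euclidean_space \<Rightarrow> real)"
    and integral_heat_kernel: "(LINT x::'a|lborel. heat_kernel t x) = 1"
proof -
  have i: "integrable lborel (\<lambda>x::'a. complex_of_real (heat_kernel t x))"
    using integrable_fourier_heat_kernel[OF assms, of 0] by simp
  then show "integrable lborel (heat_kernel t :: 'a \<Rightarrow> real)"
    by (simp add: complex_of_real_integrable_eq)
  have "complex_of_real (LINT x::'a|lborel. heat_kernel t x) = 1"
    using fourier_heat_kernel[OF assms, of "0 :: 'a"] by (simp add: fourier_def)
  then show "(LINT x::'a|lborel. heat_kernel t x) = 1" by simp
qed

subsection \<open>The reflected kernel of the half space\<close>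

text \<open>A single term of the exponential series is at most its sum. Below it is the device that
  lets a Gaussian absorb polynomial factors.\<close>

lemma power_le_fact_exp:
  fixes x :: real
  assumes "x \<ge> 0"
  shows "x ^ n \<le> fact n * exp x"
proof -
  have "(\<Sum>k\<in>{n}. x ^ k /\<^sub>R fact k) \<le> exp x"
    using exp_converges[of x] assms
    by (metis (no_types, lifting) finite.emptyI finite.insertI sum_le_suminf sums_iff
        scaleR_nonneg_nonneg zero_le_power inverse_nonnegative_iff_nonnegative fact_ge_zero)
  then show ?thesis by (simp add: field_simps)
qed

text \<open>In terms of 1/t this is a power against an exponential. The real exponent
  \<open>p\<close> is raised to the integer \<open>n\<close> when 1/t > 1, and otherwise the power
  is at most 1; the two cases account for the two summands of the constant.\<close>

lemma powr_exp_inverse_bounded: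
  fixes a p :: real
  assumes "a > 0" "p \<ge> 0"
  obtains C where "C > 0" "\<And>t. t > 0 \<Longrightarrow> t powr (- p) * exp (- a / t) \<le> C"
proof -
  define n where "n = nat \<lceil>p\<rceil>"
  have n: "p \<le> real n" using assms by (simp add: n_def)
  have "t powr (- p) * exp (- a / t) \<le> 1 + fact n / a ^ n" if t: "t > 0" for t
  proof -
    have "(1 / t) powr p \<le> 1 + (1 / t) ^ n"
    proof (cases "1 / t \<le> 1")
      case True
      then have "(1 / t) powr p \<le> 1" using t assms by (intro powr_le1) auto
      then show ?thesis using t by (simp add: add_increasing2)
    next
      case False
      then have "(1 / t) powr p \<le> (1 / t) powr real n" using n by (intro powr_mono) auto
      then show ?thesis using t by (simp add: powr_realpow)
    qed
    moreover have "(1 / t) ^ n \<le> fact n / a ^ n * exp (a / t)"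
      using power_le_fact_exp[of "a / t" n] assms t by (simp add: power_divide field_simps)
    moreover have "1 \<le> exp (a / t)" using assms t by simp
    ultimately have "(1 / t) powr p \<le> (1 + fact n / a ^ n) * exp (a / t)"
      unfolding distrib_right by linarith
    moreover have "t powr (- p) * exp (- a / t) = (1 / t) powr p / exp (a / t)"
      using t by (simp add: powr_minus powr_divide exp_minus field_simps)
    ultimately show ?thesis by (simp add: pos_divide_le_eq)
  qed
  then show thesis using assms by (intro that[of "1 + fact n / a ^ n"]) (auto intro: add_pos_nonneg)
qed

text \<open>Off the diagonal the kernel vanishes faster than any power of \<open>t\<close> as
  \<open>t\<close> tends to 0. The linear rate, valid for all \<open>t > 0\<close> at once, is
  chosen because it cancels the 1/t in the bound for the reflected kernel.\<close>

lemma heat_kernel_off_diagonal: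
  assumes "\<delta> > 0"
  obtains C where "C > 0"
    "\<And>t w :: 'a::euclidean_space. t > 0 \<Longrightarrow> \<delta> \<le> norm w \<Longrightarrow> heat_kernel t w \<le> C * t"
proof -
  define N where "N = real DIM('a)"
  obtain C where C: "C > 0" "\<And>t. t > 0 \<Longrightarrow> t powr (- (N / 2 + 1)) * exp (- (\<delta>\<^sup>2 / 4) / t) \<le> C"
    using powr_exp_inverse_bounded[of "\<delta>\<^sup>2 / 4" "N / 2 + 1"] assms by (auto simp: N_def)
  show thesis
  proof (rule that)
    show "(4 * pi) powr (- N / 2) * C > 0" using C by simp
    fix t :: real and w :: 'a
    assume t: "t > 0" and w: "\<delta> \<le> norm w"
    have "t powr (- N / 2) = t powr (- (N / 2 + 1)) * t"
      using t powr_add[of t "- (N / 2 + 1)" 1] by simp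
    then have "heat_kernel t w = (4 * pi) powr (- N / 2) * (t powr (- (N / 2 + 1)) * exp (- (norm w)\<^sup>2 / (4 * t))) * t"
      using t by (simp add: heat_kernel_def N_def powr_mult)
    also have "\<dots> \<le> (4 * pi) powr (- N / 2) * (t powr (- (N / 2 + 1)) * exp (- (\<delta>\<^sup>2 / 4) / t)) * t"
      using t w assms by (intro mult_right_mono mult_left_mono) (auto intro!: divide_right_mono power_mono)
    also have "\<dots> \<le> (4 * pi) powr (- N / 2) * C * t"
      using C(2)[OF t] t by (intro mult_right_mono mult_left_mono) auto
    finally show "heat_kernel t w \<le> (4 * pi) powr (- N / 2) * C * t" .
  qed
qed

lemma heat_kernel_scale:
  fixes w :: "'a::euclidean_space"
  assumes "s > 0"
  shows "sqrt s ^ DIM('a) * heat_kernel s (sqrt s *\<^sub>R w) = heat_kernel 1 w"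
proof -
  define c where "c = real DIM('a) / 2"
  have 1: "(4 * pi * s) powr (- c) = (4 * pi) powr (- c) * s powr (- c)"
    using assms by (simp add: powr_mult)
  have 2: "sqrt s ^ DIM('a) = s powr c"
    using assms by (simp add: powr_half_sqrt[symmetric] powr_power c_def)
  have 3: "s powr c * s powr (- c) = 1"
    using assms by (simp add: powr_add[symmetric])
  have 4: "- (norm (sqrt s *\<^sub>R w))\<^sup>2 / (4 * s) = - (norm w)\<^sup>2 / (4 * 1)"
    using assms by (simp add: power_mult_distrib)
  have "sqrt s ^ DIM('a) * ((4 * pi * s) powr (- c) * exp (- (norm (sqrt s *\<^sub>R w))\<^sup>2 / (4 * s))) =
    (s powr c * s powr (- c)) * ((4 * pi) powr (- c) * exp (- (norm w)\<^sup>2 / (4 * 1)))"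
    unfolding 1 2 4 by (simp only: mult_ac)
  with 3 show ?thesis
    by (simp add: heat_kernel_def c_def)
qed

lemma integrable_bounded_mult_heat_kernel:
  fixes k :: "'a::euclidean_space \<Rightarrow> real"
  assumes [measurable]: "k \<in> borel_measurable borel" and M: "\<And>y. \<bar>k y\<bar> \<le> M" and s: "s > 0"
  shows "integrable lborel (\<lambda>y. k y * heat_kernel s (y - z))"
proof (rule Bochner_Integration.integrable_bound)
  have "integrable (distr lborel borel ((+) (- z))) (heat_kernel s :: 'a \<Rightarrow> real)"
    unfolding lborel_distr_plus by (rule integrable_heat_kernel[OF s])
  then have "integrable lborel (\<lambda>y::'a. heat_kernel s (- z + y))"
    by (subst (asm) integrable_distr_eq) auto
  then show "integrable lborel (\<lambda>y. M * heat_kernel s (y - z))"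
    by (simp add: add.commute)
  show "AE y in lborel. norm (k y * heat_kernel s (y - z)) \<le> norm (M * heat_kernel s (y - z))"
  proof (rule AE_I2)
    fix y
    have "\<bar>k y\<bar> \<le> \<bar>M\<bar>" using M[of y] by linarith
    then show "norm (k y * heat_kernel s (y - z)) \<le> norm (M * heat_kernel s (y - z))"
      by (simp add: abs_mult mult_right_mono)
  qed
qed auto

text \<open>The substitution y = z + sqrt(s) w turns the concentrating kernels into the fixed
  \<open>heat_kernel 1\<close>, and dominated convergence applies. Continuity is asked at
  \<open>z\<close> only, so that \<open>k\<close> may be a function cut off outside a ball.\<close>

lemma heat_kernel_approximate_identity:
  fixes k :: "'a::euclidean_space \<Rightarrow> real"
  assumes [measurable]: "k \<in> borel_measurable borel" and M: "\<And>y. \<bar>k y\<bar> \<le> M" and z: "isCont k z"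
    and s: "\<And>n. s n > 0" "s \<longlonglongrightarrow> 0"
  shows "(\<lambda>n. LINT y|lborel. k y * heat_kernel (s n) (y - z)) \<longlonglongrightarrow> k z"
proof -
  have sub: "(LINT y|lborel. k y * heat_kernel (s n) (y - z)) =
      (LINT w|lborel. k (z + sqrt (s n) *\<^sub>R w) * heat_kernel 1 w)" for n
  proof -
    have c: "sqrt (s n) \<noteq> 0" "\<bar>sqrt (s n)\<bar> = sqrt (s n)" using s(1)[of n] by auto
    have "(LINT y|lborel. k y * heat_kernel (s n) (y - z)) =
      (LINT y|density (distr lborel borel (\<lambda>w. z + sqrt (s n) *\<^sub>R w)) (\<lambda>_. ennreal (sqrt (s n) ^ DIM('a))).
        k y * heat_kernel (s n) (y - z))"
      using lborel_affine[OF c(1), of z] c(2) by (simp add: ennreal_power)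
    also have "\<dots> = (LINT w|lborel. sqrt (s n) ^ DIM('a) * (k (z + sqrt (s n) *\<^sub>R w) * heat_kernel (s n) (sqrt (s n) *\<^sub>R w)))"
      using s(1)[of n] by (subst integral_density) (auto simp: integral_distr)
    also have "\<dots> = (LINT w|lborel. k (z + sqrt (s n) *\<^sub>R w) * heat_kernel 1 w)"
    proof (rule Bochner_Integration.integral_cong[OF refl])
      fix w :: 'a
      show "sqrt (s n) ^ DIM('a) * (k (z + sqrt (s n) *\<^sub>R w) * heat_kernel (s n) (sqrt (s n) *\<^sub>R w)) =
        k (z + sqrt (s n) *\<^sub>R w) * heat_kernel 1 w"
        using heat_kernel_scale[OF s(1)[of n], of w] by (metis mult.left_commute)
    qed
    finally show ?thesis .
  qed
  have "(\<lambda>n. LINT w|lborel. k (z + sqrt (s n) *\<^sub>R w) * heat_kernel 1 w) \<longlonglongrightarrow> (LINT w::'a|lborel. k z * heat_kernel 1 w)"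
  proof (rule integral_dominated_convergence)
    show "integrable lborel (\<lambda>w::'a. M * heat_kernel 1 w)"
      by (intro integrable_mult_right integrable_heat_kernel) simp
    show "AE w in lborel. (\<lambda>n. k (z + sqrt (s n) *\<^sub>R w) * heat_kernel 1 w) \<longlonglongrightarrow> k z * heat_kernel 1 w"
    proof (rule AE_I2)
      fix w :: 'a
      have "(\<lambda>n. z + sqrt (s n) *\<^sub>R w) \<longlonglongrightarrow> z + sqrt 0 *\<^sub>R w"
        by (intro tendsto_intros s)
      then have "(\<lambda>n. k (z + sqrt (s n) *\<^sub>R w)) \<longlonglongrightarrow> k z"
        using z isCont_tendsto_compose[of z k] by simp
      then show "(\<lambda>n. k (z + sqrt (s n) *\<^sub>R w) * heat_kernel 1 w) \<longlonglongrightarrow> k z * heat_kernel 1 w"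
        by (intro tendsto_intros)
    qed
    show "AE w in lborel. norm (k (z + sqrt (s n) *\<^sub>R w) * heat_kernel 1 w) \<le> M * heat_kernel 1 w" for n
      using M by (auto intro!: AE_I2 mult_right_mono simp: abs_mult heat_kernel_nonneg)
  qed auto
  then show ?thesis
    by (simp add: sub integral_heat_kernel)
qed

definition reflect :: "real \<times> 'a \<Rightarrow> real \<times> 'a" where
  "reflect z = (- fst z, snd z)"

text \<open>The method of images: a negative mirror source makes the kernel odd in the normal
  coordinate of either argument, hence zero on the boundary.\<close>

definition half_space_kernel :: "real \<Rightarrow> real \<times> 'a::euclidean_space \<Rightarrow> real \<times> 'a \<Rightarrow> real" where
  "half_space_kernel t x z = heat_kernel t (x - z) - heat_kernel t (x - reflect z)"

lemma power2_norm_prod: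
  fixes p :: "real \<times> 'a::real_normed_vector"
  shows "(norm p)\<^sup>2 = (fst p)\<^sup>2 + (norm (snd p))\<^sup>2"
  by (cases p) (simp add: norm_Pair)

text \<open>The squared distances to the source and to its mirror image differ by
  \<open>4 * (fst x * fst z)\<close>, so the image term is the direct one times an exponential. In
  this form positivity and the first-order vanishing at the boundary are visible.\<close>

lemma half_space_kernel_eq:
  assumes "t > 0"
  shows "half_space_kernel t x z = heat_kernel t (x - z) * (1 - exp (- (fst x * fst z / t)))"
proof -
  have "(norm (x - reflect z))\<^sup>2 = (norm (x - z))\<^sup>2 + 4 * (fst x * fst z)"
    by (simp add: power2_norm_prod reflect_def) (simp add: power2_eq_square algebra_simps)
  then have "- (norm (x - reflect z))\<^sup>2 / (4 * t) = - (norm (x - z))\<^sup>2 / (4 * t) + - (fst x * fst z / t)"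
    using assms by (simp add: field_simps)
  then have "heat_kernel t (x - reflect z) = heat_kernel t (x - z) * exp (- (fst x * fst z / t))"
    unfolding heat_kernel_def by (simp only: exp_add mult.assoc)
  then show ?thesis by (simp add: half_space_kernel_def algebra_simps)
qed

lemma half_space_kernel_commute: "half_space_kernel t x z = half_space_kernel t z x"
proof -
  have "norm (x - z) = norm (z - x)" "norm (x - reflect z) = norm (z - reflect x)"
    by (simp_all add: norm_minus_commute reflect_def norm_prod_def add.commute power2_commute)
  then show ?thesis by (simp add: half_space_kernel_def heat_kernel_def)
qed

lemma half_space_kernel_bounds:
  assumes "t > 0" "fst x \<ge> 0" "fst z \<ge> 0"
  shows "0 \<le> half_space_kernel t x z"
    and "half_space_kernel t x z \<le> heat_kernel t (x - z) * min 1 (fst x * fst z / t)"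
proof -
  have "fst x * fst z / t \<ge> 0" using assms by simp
  moreover have "1 - exp (- (fst x * fst z / t)) \<le> fst x * fst z / t"
    using exp_ge_add_one_self[of "- (fst x * fst z / t)"] by linarith
  ultimately have "0 \<le> 1 - exp (- (fst x * fst z / t))" "1 - exp (- (fst x * fst z / t)) \<le> min 1 (fst x * fst z / t)"
    by auto
  then show "0 \<le> half_space_kernel t x z"
    "half_space_kernel t x z \<le> heat_kernel t (x - z) * min 1 (fst x * fst z / t)"
    unfolding half_space_kernel_eq[OF assms(1)]
    by (auto intro!: mult_left_mono mult_nonneg_nonneg heat_kernel_nonneg simp del: min_def)
qed

lemma half_space_kernel_boundary [simp]: "fst z = 0 \<Longrightarrow> half_space_kernel t x z = 0"
  by (cases z) (simp add: half_space_kernel_def reflect_def)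

lemma closure_half_space: "closure (half_space :: (real \<times> (real ^ 'm)) set) = {0..} \<times> UNIV"
  by (simp add: half_space_def closure_Times)

lemma open_half_space: "open (half_space :: (real \<times> (real ^ 'm)) set)"
  by (simp add: half_space_def open_Times)

lemma frontier_half_space: "frontier (half_space :: (real \<times> (real ^ 'm)) set) = {0} \<times> UNIV"
  unfolding frontier_def interior_open[OF open_half_space] closure_half_space
  by (auto simp: half_space_def)

text \<open>Transfers explicit total derivatives to the iterated \<open>partials\<close>; for order
  2 only lists of at most two basis vectors have to be examined.\<close>

lemma
  fixes f :: "'a::euclidean_space \<Rightarrow> real"
  assumes f': "\<And>x. (f has_derivative f' x) (at x)"
    and f'': "\<And>b x. b \<in> Basis \<Longrightarrow> ((\<lambda>x. f' x b) has_derivative f'' b x) (at x)"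
    and cont: "\<And>b b'. b \<in> Basis \<Longrightarrow> b' \<in> Basis \<Longrightarrow> continuous_on UNIV (\<lambda>x. f'' b x b')"
  shows Ck_on_2I: "Ck_on 2 D f" and laplacian_eqI: "laplacian f x = (\<Sum>b\<in>Basis. f'' b x b)"
proof -
  have p1: "partial b f = (\<lambda>x. f' x b)" for b
    using partial_eq[OF f'] by (intro ext)
  have p2: "partial b' (\<lambda>x. f' x b) = (\<lambda>x. f'' b x b')" if "b \<in> Basis" for b b'
    using partial_eq[OF f''[OF that]] by (intro ext)
  show "laplacian f x = (\<Sum>b\<in>Basis. f'' b x b)"
    by (simp add: laplacian_def p1 p2)
  have d: "f differentiable_on D" "\<And>b. b \<in> Basis \<Longrightarrow> (\<lambda>x. f' x b) differentiable_on D"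
    unfolding differentiable_on_def differentiable_def
    using has_derivative_at_withinI[OF f'] has_derivative_at_withinI[OF f''] by blast+
  have c2: "continuous_on D (\<lambda>x. f'' b x b')" if "b \<in> Basis" "b' \<in> Basis" for b b'
    by (rule continuous_on_subset[OF cont[OF that]]) simp
  show "Ck_on 2 D f"
    unfolding Ck_on_def
  proof (intro conjI allI impI)
    fix bs :: "'a list" assume "set bs \<subseteq> Basis \<and> length bs < 2"
    then have "set bs \<subseteq> Basis" "bs = [] \<or> (\<exists>b. bs = [b])" by (cases bs; auto)+
    then show "partials bs f differentiable_on D" using d by (auto simp: p1)
  next
    fix bs :: "'a list" assume "set bs \<subseteq> Basis \<and> length bs \<le> 2"
    then have "set bs \<subseteq> Basis" "bs = [] \<or> (\<exists>b. bs = [b]) \<or> (\<exists>b' b. bs = [b', b])"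
      by (cases bs; cases "tl bs"; auto)+
    then show "continuous_on D (partials bs f)"
      using d c2 by (auto simp: p1 p2 intro: differentiable_imp_continuous_on)
  qed
qed

lemma has_derivative_heat_kernel_translate:
  assumes "t > 0"
  shows "((\<lambda>x. heat_kernel t (x - z)) has_derivative (\<lambda>h. - ((x - z) \<bullet> h) / (2 * t) * heat_kernel t (x - z))) (at x)"
proof -
  have "((\<lambda>x. x - z) has_derivative (\<lambda>h. h)) (at x)" by (auto intro!: derivative_eq_intros)
  from has_derivative_compose[OF this has_derivative_heat_kernel[OF assms]] show ?thesis .
qed

lemma has_derivative_heat_kernel_translate2:
  assumes "t > 0"
  shows "((\<lambda>x. - ((x - z) \<bullet> b) / (2 * t) * heat_kernel t (x - z)) has_derivative
     (\<lambda>h. (- (h \<bullet> b) / (2 * t) + ((x - z) \<bullet> b) * ((x - z) \<bullet> h) / (4 * t\<^sup>2)) * heat_kernel t (x - z))) (at x)"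
  using assms
  by (auto intro!: derivative_eq_intros has_derivative_heat_kernel_translate
      simp: fun_eq_iff field_simps power2_eq_square)

text \<open>The trace of the spatial second derivative carries the same factor as the time
  derivative of the kernel: this is the heat equation.\<close>

lemma sum_Basis_heat_kernel:
  fixes w :: "'a::euclidean_space"
  assumes "t > 0"
  shows "(\<Sum>b\<in>Basis. (- (b \<bullet> b) / (2 * t) + (w \<bullet> b) * (w \<bullet> b) / (4 * t\<^sup>2)) * c) =
    (- real DIM('a) / (2 * t) + (norm w)\<^sup>2 / (4 * t\<^sup>2)) * c"
proof -
  have "(norm w)\<^sup>2 = (\<Sum>b\<in>Basis. (w \<bullet> b) * (w \<bullet> b))"
    unfolding power2_norm_eq_inner by (rule euclidean_inner)
  then show ?thesis
    by (simp add: sum_distrib_right[symmetric] sum_subtractf sum_divide_distrib[symmetric])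
qed

text \<open>Starting the clock at \<open>s > 0\<close> avoids the singularity of the kernel at time
  0, so the solution is bounded and continuous up to the initial time. The source and its image both
  solve the heat equation, and by symmetry in the arguments their difference vanishes for
  \<open>x\<close> on the boundary.\<close>

lemma heat_dirichlet_solution_half_space_kernel:
  fixes z :: "real \<times> (real ^ 'm)"
  assumes s: "s > 0"
  shows "heat_dirichlet_solution half_space (\<lambda>x. half_space_kernel s x z) (\<lambda>t x. half_space_kernel (t + s) x z)"
proof -
  define H' where "H' t w h = - (w \<bullet> h) / (2 * t) * heat_kernel t w" for t and w h :: "real \<times> (real ^ 'm)"
  define H'' where "H'' t w b h = (- (h \<bullet> b) / (2 * t) + (w \<bullet> b) * (w \<bullet> h) / (4 * t\<^sup>2)) * heat_kernel t w"
    for t and w b h :: "real \<times> (real ^ 'm)"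
  have d1: "((\<lambda>x. half_space_kernel t x z) has_derivative (\<lambda>h. H' t (x - z) h - H' t (x - reflect z) h)) (at x)"
    if "t > 0" for t x
    unfolding half_space_kernel_def H'_def
    by (intro has_derivative_diff has_derivative_heat_kernel_translate that)
  have d2: "((\<lambda>x. H' t (x - z) b - H' t (x - reflect z) b) has_derivative
      (\<lambda>h. H'' t (x - z) b h - H'' t (x - reflect z) b h)) (at x)" if "t > 0" for t x b
    unfolding H'_def H''_def
    by (intro has_derivative_diff has_derivative_heat_kernel_translate2 that)
  have c: "continuous_on UNIV (\<lambda>x. H'' t (x - z) b h - H'' t (x - reflect z) b h)" if "t > 0" for t b h
    unfolding H''_def using that by (intro continuous_intros) auto
  have lap: "laplacian (\<lambda>x. half_space_kernel t x z) x =
    (- real DIM(real \<times> (real ^ 'm)) / (2 * t) + (norm (x - z))\<^sup>2 / (4 * t\<^sup>2)) * heat_kernel t (x - z) -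
    (- real DIM(real \<times> (real ^ 'm)) / (2 * t) + (norm (x - reflect z))\<^sup>2 / (4 * t\<^sup>2)) * heat_kernel t (x - reflect z)"
    if "t > 0" for t x
    by (subst laplacian_eqI[OF d1 d2 c]) (simp_all only: that H''_def sum_subtractf sum_Basis_heat_kernel)
  have time: "((\<lambda>r. half_space_kernel (r + s) x z) has_real_derivative
      laplacian (\<lambda>x. half_space_kernel (t + s) x z) x) (at t)" if "t > 0" for t x
  proof -
    have ts: "t + s > 0" using that s by simp
    have "((\<lambda>r. half_space_kernel r x z) has_real_derivative laplacian (\<lambda>x. half_space_kernel (t + s) x z) x) (at (t + s))"
      unfolding lap[OF ts] unfolding half_space_kernel_def
      by (intro DERIV_diff has_real_derivative_heat_kernel_time ts)
    then show ?thesis by (simp add: DERIV_shift)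
  qed
  define B where "B = (4 * pi * s) powr (- real DIM(real \<times> (real ^ 'm)) / 2)"
  have bound: "\<bar>half_space_kernel (t + s) x z\<bar> \<le> B" if "t \<ge> 0" for t x
    using heat_kernel_le[of s "t + s" "x - z"] heat_kernel_le[of s "t + s" "x - reflect z"]
      heat_kernel_nonneg[of "t + s" "x - z"] heat_kernel_nonneg[of "t + s" "x - reflect z"] s that
    unfolding half_space_kernel_def B_def by auto
  show ?thesis
    unfolding heat_dirichlet_solution_def
  proof (intro conjI ballI allI impI)
    have "continuous_on ({0..} \<times> closure half_space) (\<lambda>p. half_space_kernel (fst p + s) (snd p) z)"
      unfolding half_space_kernel_def using s by (intro continuous_intros) auto
    then show "continuous_on ({0..} \<times> closure half_space) (\<lambda>(t, x). half_space_kernel (t + s) x z)"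
      by (simp add: case_prod_beta)
    show "bounded ((\<lambda>(t, x). half_space_kernel (t + s) x z) ` ({0..} \<times> closure half_space))"
      unfolding bounded_iff using bound by (intro exI[of _ B]) auto
    show "Ck_on 2 half_space (\<lambda>x. half_space_kernel (t + s) x z)" if "t > 0" for t
      using Ck_on_2I[OF d1 d2 c] that s by simp
    show "((\<lambda>r. half_space_kernel (r + s) x z) has_real_derivative
      laplacian (\<lambda>x. half_space_kernel (t + s) x z) x) (at t)" if "t > 0" for t x
      using time that by simp
    show "half_space_kernel (t + s) x z = 0" if "x \<in> frontier half_space" for t x
      using that by (subst half_space_kernel_commute) (auto simp: frontier_half_space)
  qed simp
qed

section \<open>Identification of the Dirichlet heat kernel\<close>

lemma abs_fst_le_norm:
  fixes p :: "real \<times> 'a::real_normed_vector"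
  shows "\<bar>fst p\<bar> \<le> norm p"
  using norm_fst_le[of "fst p" "snd p"] by simp

lemma half_space_kernel_time_tendsto:
  assumes t: "t > 0" and s: "s \<longlonglongrightarrow> 0"
  shows "(\<lambda>n. half_space_kernel (t + s n) x z) \<longlonglongrightarrow> half_space_kernel t x z"
proof -
  have "continuous_on {0<..} (\<lambda>r. half_space_kernel r x z)"
    unfolding half_space_kernel_def by (intro continuous_intros) auto
  then have "isCont (\<lambda>r. half_space_kernel r x z) t"
    using t by (simp add: continuous_on_eq_continuous_at)
  moreover have "(\<lambda>n. t + s n) \<longlonglongrightarrow> t" using tendsto_add[OF tendsto_const s, of t] by simp
  ultimately show ?thesis by (rule isCont_tendsto_compose)
qed

text \<open>The function \<open>g\<close>, later \<open>G t x\<close>, may be unbounded, and its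
  size is controlled only through integrability against \<open>min 1 (fst y)\<close>. Near
  \<open>z\<close> it is bounded, and the ordinary approximate identity applies to its truncation
  \<open>k\<close>; the integral of the error \<open>R\<close> made by this replacement tends to 0
  by dominated convergence.\<close>

lemma half_space_kernel_approximate_identity:
  fixes g :: "real \<times> (real ^ 'm) \<Rightarrow> real"
  assumes cont: "continuous_on half_space g"
    and int: "set_integrable lborel half_space (\<lambda>y. g y * min 1 (fst y))"
    and intk: "\<And>s. s > 0 \<Longrightarrow> set_integrable lborel half_space (\<lambda>y. g y * half_space_kernel s y z)"
    and z: "z \<in> half_space"
    and s: "\<And>n. 0 < s n" "\<And>n. s n \<le> 1" "s \<longlonglongrightarrow> 0"
  shows "(\<lambda>n. LBINT y:half_space. g y * half_space_kernel (s n) y z) \<longlonglongrightarrow> g z"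
proof -
  let ?D = "half_space :: (real \<times> (real ^ 'm)) set"
  have z0: "fst z > 0" using z by (auto simp: half_space_def)
  \<comment> \<open>Half the distance from \<open>z\<close> to the boundary, so the closed ball
    stays inside the half space.\<close>
  define \<delta> where "\<delta> = fst z / 2"
  have \<delta>: "\<delta> > 0" using z0 by (simp add: \<delta>_def)
  define B where "B = cball z \<delta>"
  have BD: "B \<subseteq> ?D"
  proof
    fix y assume "y \<in> B"
    then have "\<bar>fst z - fst y\<bar> \<le> \<delta>"
      using abs_fst_le_norm[of "z - y"] by (simp add: B_def dist_norm)
    then have "fst y > 0" using \<delta> unfolding \<delta>_def abs_le_iff by linarith
    then show "y \<in> ?D" unfolding half_space_def by (cases y) auto
  qed
  have "compact (g ` B)"
    using continuous_on_subset[OF cont BD] by (intro compact_continuous_image) (auto simp: B_def)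
  then obtain M where M: "\<And>y. y \<in> B \<Longrightarrow> \<bar>g y\<bar> \<le> M" "M > 0"
    using compact_imp_bounded bounded_pos by (metis image_eqI real_norm_def)
  define k where "k y = indicator B y * g y" for y
  have [measurable]: "k \<in> borel_measurable borel"
    using borel_measurable_continuous_on_indicator[of B g] continuous_on_subset[OF cont BD]
    by (simp add: k_def[abs_def] B_def)
  have kM: "\<bar>k y\<bar> \<le> M" for y using M by (auto simp: k_def indicator_def)
  have "isCont k z"
  proof -
    have "continuous_on (ball z \<delta>) k"
      by (subst continuous_on_cong[OF refl, of _ _ g])
        (use BD in \<open>auto simp: k_def B_def intro!: continuous_on_subset[OF cont] dest: subsetD[OF BD]\<close>)
    then show ?thesis using \<delta> by (simp add: continuous_on_eq_continuous_at)
  qed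
  then have lim: "(\<lambda>n. LINT y|lborel. k y * heat_kernel (s n) (y - z)) \<longlonglongrightarrow> k z"
    by (intro heat_kernel_approximate_identity[OF _ kM]) (use s in auto)
  obtain C where C: "C > 0"
    "\<And>t w :: real \<times> (real ^ 'm). t > 0 \<Longrightarrow> \<delta> \<le> norm w \<Longrightarrow> heat_kernel t w \<le> C * t"
    using heat_kernel_off_diagonal[OF \<delta>] by blast
  define R where "R n y = indicator ?D y * (g y * half_space_kernel (s n) y z) - k y * heat_kernel (s n) (y - z)"
    for n y
  \<comment> \<open>Inside the ball the direct Gaussians cancel and only the image term is left,
    whose source has distance at least \<open>\<delta>\<close> from \<open>y\<close>.\<close>
  have RB: "\<bar>R n y\<bar> \<le> C * s n * M" if y: "y \<in> B" for n y
  proof -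
    have yD: "y \<in> ?D" using y BD by blast
    have "\<delta> \<le> \<bar>fst (y - reflect z)\<bar>"
      using yD z0 by (auto simp: reflect_def half_space_def \<delta>_def)
    also have "\<dots> \<le> norm (y - reflect z)"
      by (rule abs_fst_le_norm)
    finally have "heat_kernel (s n) (y - reflect z) \<le> C * s n" using C(2) s(1) by blast
    moreover have "R n y = - (heat_kernel (s n) (y - reflect z) * g y)"
      using y yD by (simp add: R_def k_def half_space_kernel_def algebra_simps)
    ultimately show ?thesis
      using M(1)[OF y] C(1) s(1)[of n] heat_kernel_nonneg[of "s n" "y - reflect z"]
      by (auto simp: abs_mult intro!: mult_mono)
  qed
  \<comment> \<open>The minimum serves two purposes: \<open>s n\<close> makes the bound tend to 0,
    and \<open>fst y * fst z\<close> supplies the decay at the boundary that matches the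
    integrability assumed of \<open>g\<close>.\<close>
  have RD: "\<bar>R n y\<bar> \<le> \<bar>g y\<bar> * (C * min (s n) (fst y * fst z))" if y: "y \<in> ?D" "y \<notin> B" for n y
  proof -
    have y0: "fst y > 0" using y(1) by (auto simp: half_space_def)
    have "\<delta> \<le> norm (y - z)" using y(2) by (simp add: B_def dist_norm norm_minus_commute)
    then have "heat_kernel (s n) (y - z) \<le> C * s n" using C(2) s(1) by blast
    moreover have "0 \<le> half_space_kernel (s n) y z"
      "half_space_kernel (s n) y z \<le> heat_kernel (s n) (y - z) * min 1 (fst y * fst z / s n)"
      using half_space_kernel_bounds[of "s n" y z] s(1) y0 z0 by auto
    moreover have "0 \<le> min 1 (fst y * fst z / s n)" using s(1)[of n] y0 z0 by simp
    ultimately have "half_space_kernel (s n) y z \<le> C * s n * min 1 (fst y * fst z / s n)"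
      by (meson mult_right_mono order_trans)
    also have "\<dots> = C * min (s n) (fst y * fst z)"
    proof -
      have "s n * min 1 (fst y * fst z / s n) = min (s n) (fst y * fst z)"
        using s(1)[of n] by (auto simp: min_def field_simps)
      then show ?thesis by (simp only: mult.assoc)
    qed
    finally have "half_space_kernel (s n) y z \<le> C * min (s n) (fst y * fst z)" .
    moreover have "R n y = g y * half_space_kernel (s n) y z"
      using y by (simp add: R_def k_def)
    ultimately show ?thesis
      using \<open>0 \<le> half_space_kernel (s n) y z\<close> by (auto simp: abs_mult intro!: mult_left_mono)
  qed
  have R0: "R n y = 0" if "y \<notin> ?D" for n y
    using that BD by (auto simp: R_def k_def indicator_def)
  have Dm [measurable]: "?D \<in> sets borel" using open_half_space by (rule borel_open)
  have intA: "integrable lborel (\<lambda>y. k y * heat_kernel (s n) (y - z))" for n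
    by (intro integrable_bounded_mult_heat_kernel[OF _ kM]) (use s in auto)
  have intD: "integrable lborel (\<lambda>y. indicator ?D y * (g y * half_space_kernel (s n) y z))" for n
    using intk[OF s(1)[of n]] by (simp add: set_integrable_def)
  have "(\<lambda>n. LINT y|lborel. R n y) \<longlonglongrightarrow> (LINT y::(real \<times> (real ^ 'm))|lborel. 0)"
  proof (rule integral_dominated_convergence)
    show "integrable lborel (\<lambda>y. indicator B y * (C * M) + (C * (1 + fst z)) * \<bar>indicator ?D y * (g y * min 1 (fst y))\<bar>)"
    proof (intro Bochner_Integration.integrable_add integrable_mult_right integrable_abs)
      show "integrable lborel (\<lambda>y. indicator B y * (C * M))"
        using emeasure_bounded_finite[OF bounded_cball, of z \<delta>]
        unfolding B_def by (intro integrable_mult_left integrable_real_indicator) (auto simp: less_top)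
      show "integrable lborel (\<lambda>y. indicator ?D y * (g y * min 1 (fst y)))"
        using int by (simp add: set_integrable_def)
    qed
    show "AE y in lborel. (\<lambda>n. R n y) \<longlonglongrightarrow> 0"
    proof (rule AE_I2)
      fix y
      have "\<bar>R n y\<bar> \<le> C * (M + \<bar>g y\<bar>) * s n" for n
      proof -
        have nn: "0 \<le> C * s n * M" "0 \<le> C * s n * \<bar>g y\<bar>" using C(1) s(1)[of n] M(2) by auto
        have "\<bar>g y\<bar> * (C * min (s n) (fst y * fst z)) \<le> \<bar>g y\<bar> * (C * s n)"
          using C(1) by (intro mult_left_mono) auto
        then show ?thesis using RB[of y n] RD[of y n] R0[of y n] nn
          by (cases "y \<in> B"; cases "y \<in> ?D") (auto simp: algebra_simps)
      qed
      moreover have "(\<lambda>n. C * (M + \<bar>g y\<bar>) * s n) \<longlonglongrightarrow> C * (M + \<bar>g y\<bar>) * 0"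
        by (intro tendsto_intros s)
      ultimately show "(\<lambda>n. R n y) \<longlonglongrightarrow> 0"
        by (intro Lim_null_comparison[of "\<lambda>n. R n y" "\<lambda>n. C * (M + \<bar>g y\<bar>) * s n"]) auto
    qed
    show "AE y in lborel. norm (R n y) \<le> indicator B y * (C * M) + (C * (1 + fst z)) * \<bar>indicator ?D y * (g y * min 1 (fst y))\<bar>" for n
    proof (rule AE_I2)
      fix y
      have nn: "0 \<le> (C * (1 + fst z)) * \<bar>indicator ?D y * (g y * min 1 (fst y))\<bar>"
        using C(1) z0 by (intro mult_nonneg_nonneg) auto
      consider "y \<in> B" | "y \<in> ?D" "y \<notin> B" | "y \<notin> ?D" "y \<notin> B" using BD by auto
      then show "norm (R n y) \<le> indicator B y * (C * M) + (C * (1 + fst z)) * \<bar>indicator ?D y * (g y * min 1 (fst y))\<bar>"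
      proof cases
        case 1
        have "C * s n * M \<le> C * 1 * M" using C(1) s(2)[of n] M(2) by (intro mult_right_mono mult_left_mono) auto
        then show ?thesis using RB[OF 1, of n] nn 1 by simp
      next
        case 2
        then have y0: "fst y > 0" by (auto simp: half_space_def)
        \<comment> \<open>Split at \<open>fst y = 1\<close>: close to the boundary the second entry
          of the minimum suffices, farther away \<open>s n \<le> 1\<close> does.\<close>
        have "min (s n) (fst y * fst z) \<le> (1 + fst z) * min 1 (fst y)"
        proof (cases "fst y \<le> 1")
          case True
          have "min (s n) (fst y * fst z) \<le> fst y * fst z" by simp
          also have "\<dots> \<le> (1 + fst z) * fst y" using y0 by (simp add: algebra_simps)
          finally show ?thesis using True by (simp add: min_absorb2)
        next
          case False
          then show ?thesis using s(2)[of n] z0 by (simp add: min_absorb1 min_le_iff_disj)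
        qed
        then have "\<bar>g y\<bar> * (C * min (s n) (fst y * fst z)) \<le> \<bar>g y\<bar> * (C * ((1 + fst z) * min 1 (fst y)))"
          using C(1) by (intro mult_left_mono) auto
        then show ?thesis using RD[OF 2, of n] 2 y0 by (simp add: abs_mult mult_ac)
      next
        case 3
        then show ?thesis using R0[OF 3(1), of n] by simp
      qed
    qed
    show "R n \<in> borel_measurable lborel" for n
      unfolding R_def using intA[of n] intD[of n] by (intro borel_measurable_diff borel_measurable_integrable)
  qed simp
  from tendsto_add[OF this lim] show ?thesis
    using intA intD z \<delta>
    by (simp add: R_def set_lebesgue_integral_def Bochner_Integration.integral_diff k_def B_def)
qed

lemma dirichlet_heat_kernel_half_space_eq:
  fixes G :: "real \<Rightarrow> real \<times> (real ^ 'm) \<Rightarrow> real \<times> (real ^ 'm) \<Rightarrow> real"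
  assumes G: "dirichlet_heat_kernel half_space G" and t: "t > 0"
    and x: "x \<in> half_space" and z: "z \<in> closure half_space"
  shows "G t x z = half_space_kernel t x z"
proof (cases "fst z = 0")
  case True
  then have "z \<in> frontier half_space" by (cases z) (auto simp: frontier_half_space)
  then show ?thesis using G t x True unfolding dirichlet_heat_kernel_def by simp
next
  case False
  then have z: "z \<in> half_space" using z unfolding closure_half_space by (cases z) (auto simp: half_space_def)
  have rep: "\<exists>v. heat_dirichlet_solution half_space f v \<and>
      set_integrable lborel half_space (\<lambda>y. G t x y * f y) \<and>
      v t x = (LBINT y:half_space. G t x y * f y)"
    if "continuous_on (closure half_space) f" "bounded (f ` closure half_space)" "\<forall>x\<in>frontier half_space. f x = 0" for f
    using G t x that unfolding dirichlet_heat_kernel_def by blast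
  have xc: "x \<in> closure half_space" using x closure_subset by blast
  \<comment> \<open>\<open>min 1 (fst y)\<close> is an admissible datum: bounded, continuous and
    zero on the boundary. Its representation yields the integrability that the limit below
    requires.\<close>
  have min: "set_integrable lborel half_space (\<lambda>y. G t x y * min 1 (fst y))"
  proof -
    have "continuous_on (closure half_space) (\<lambda>y::real \<times> (real ^ 'm). min 1 (fst y))"
      by (intro continuous_intros)
    moreover have "bounded ((\<lambda>y::real \<times> (real ^ 'm). min 1 (fst y)) ` closure half_space)"
      unfolding bounded_iff by (intro exI[of _ 1]) (auto simp: closure_half_space)
    moreover have "\<forall>y\<in>frontier half_space. min 1 (fst (y :: real \<times> (real ^ 'm))) = 0"
      by (auto simp: frontier_half_space)
    ultimately show ?thesis using rep by blast
  qed
  have ker: "set_integrable lborel half_space (\<lambda>y. G t x y * half_space_kernel s y z) \<and>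
      (LBINT y:half_space. G t x y * half_space_kernel s y z) = half_space_kernel (t + s) x z" if s: "s > 0" for s
  proof -
    note sol = heat_dirichlet_solution_half_space_kernel[OF s, of z]
    have "continuous_on (closure half_space) (\<lambda>y. half_space_kernel s y z)"
      unfolding half_space_kernel_def using s by (intro continuous_intros) auto
    moreover obtain B where "\<And>t x. t \<ge> 0 \<Longrightarrow> x \<in> closure half_space \<Longrightarrow> \<bar>half_space_kernel (t + s) x z\<bar> \<le> B"
      using heat_dirichlet_solution_bounded[OF sol] by blast
    from this[of 0] have "bounded ((\<lambda>y. half_space_kernel s y z) ` closure half_space)"
      unfolding bounded_iff by (intro exI[of _ B]) auto
    moreover have "\<forall>y\<in>frontier half_space. half_space_kernel s y z = 0"
      by (subst half_space_kernel_commute) (auto simp: frontier_half_space)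
    ultimately obtain v where v: "heat_dirichlet_solution half_space (\<lambda>y. half_space_kernel s y z) v"
      "set_integrable lborel half_space (\<lambda>y. G t x y * half_space_kernel s y z)"
      "v t x = (LBINT y:half_space. G t x y * half_space_kernel s y z)"
      using rep by blast
    \<comment> \<open>The representing solution \<open>v\<close> is only known to exist; uniqueness
      makes it the explicit one.\<close>
    moreover have "v t x = half_space_kernel (t + s) x z"
      using heat_dirichlet_solution_unique[OF open_half_space v(1) sol, of t x] t xc by simp
    ultimately show ?thesis by simp
  qed
  define s where "s n = 1 / real (Suc n)" for n
  have s: "0 < s n" "s n \<le> 1" for n by (auto simp: s_def)
  have s0: "s \<longlonglongrightarrow> 0" unfolding s_def by (rule LIMSEQ_Suc[OF lim_1_over_n])
  have "continuous_on (closure half_space) (G t x)"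
    using G t x unfolding dirichlet_heat_kernel_def by blast
  then have "continuous_on half_space (G t x)"
    by (rule continuous_on_subset) (rule closure_subset)
  then have lim: "(\<lambda>n. LBINT y:half_space. G t x y * half_space_kernel (s n) y z) \<longlonglongrightarrow> G t x z"
    using ker by (intro half_space_kernel_approximate_identity min z s s0) auto
  have "(LBINT y:half_space. G t x y * half_space_kernel (s n) y z) = half_space_kernel (t + s n) x z" for n
    using ker s by blast
  with lim have "(\<lambda>n. half_space_kernel (t + s n) x z) \<longlonglongrightarrow> G t x z" by simp
  then show ?thesis
    by (rule LIMSEQ_unique) (rule half_space_kernel_time_tendsto[OF t s0])
qed

subsection \<open>The boundary kernel\<close>

text \<open>Euler's integral for \<open>Gamma\<close> after replacing t by ct. It is used for s =
  1/2, the weight t^(-1/2) e^(-lam t), and for s = 1, a plain exponential.\<close>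

lemma has_bochner_integral_powr_exp:
  fixes s c :: real
  assumes s: "s > 0" and c: "c > 0"
  shows "has_bochner_integral lborel (\<lambda>t. indicator {0<..} t * (t powr (s - 1) * exp (- c * t))) (Gamma s / c powr s)"
proof -
  have "has_bochner_integral lborel (\<lambda>t. indicator {0..} t * t powr (s - 1) / exp t) (Gamma s)"
    using Gamma_conv_nn_integral_real[OF s] s
    by (intro has_bochner_integral_nn_integral) (auto intro!: Gamma_real_nonneg)
  then have "has_bochner_integral lborel (\<lambda>t. indicator {0..} (0 + c * t) * (0 + c * t) powr (s - 1) / exp (0 + c * t)) (Gamma s /\<^sub>R \<bar>c\<bar>)"
    using c by (subst (asm) lborel_has_bochner_integral_real_affine_iff[of c _ _ 0]) auto
  then have "has_bochner_integral lborel (\<lambda>t. c powr (1 - s) * (indicator {0..} (0 + c * t) * (0 + c * t) powr (s - 1) / exp (0 + c * t)))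
     (c powr (1 - s) * (Gamma s /\<^sub>R \<bar>c\<bar>))"
    by (intro has_bochner_integral_mult_right) auto
  moreover have "c powr (1 - s) * (indicator {0..} (0 + c * t) * (0 + c * t) powr (s - 1) / exp (0 + c * t)) =
      indicator {0<..} t * (t powr (s - 1) * exp (- c * t))" for t
  proof (cases "t > 0")
    case True
    then have "c powr (1 - s) * (c * t) powr (s - 1) = t powr (s - 1)"
      using c by (simp add: powr_mult powr_diff field_simps)
    then show ?thesis using True c by (simp add: exp_minus divide_inverse mult.assoc[symmetric])
  next
    case False
    \<comment> \<open>At \<open>t = 0\<close> the closed and the open indicator differ, but
      \<open>0 powr (s - 1)\<close> is 0 by convention.\<close>
    then show ?thesis using c by (cases "t = 0") (auto simp: indicator_def zero_le_mult_iff)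
  qed
  moreover have "c powr (1 - s) * (Gamma s /\<^sub>R \<bar>c\<bar>) = Gamma s / c powr s"
    using c by (simp add: powr_diff field_simps)
  ultimately show ?thesis by simp
qed

lemma set_integrable_powr_exp:
  fixes s c :: real
  assumes "s > 0" "c > 0"
  shows "set_integrable lborel {0<..} (\<lambda>t. t powr (s - 1) * exp (- c * t))"
  using has_bochner_integral_powr_exp[OF assms] by (simp add: set_integrable_def has_bochner_integral_iff)

lemma
  fixes c :: real
  assumes c: "c > 0"
  shows set_integrable_exp: "set_integrable lborel {0<..} (\<lambda>t. exp (- c * t))"
    and set_integral_exp: "(LBINT t:{0<..}. exp (- c * t)) = 1 / c"
proof -
  have eq: "indicator {0<..} t * (t powr (1 - 1) * exp (- c * t)) = indicator {0<..} t *\<^sub>R exp (- c * t)" for t :: real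
    by (simp add: indicator_def)
  have "has_bochner_integral lborel (\<lambda>t. indicator {0<..} t *\<^sub>R exp (- c * t)) (Gamma 1 / c powr 1)"
    using has_bochner_integral_powr_exp[of 1 c] c unfolding eq by simp
  then show "set_integrable lborel {0<..} (\<lambda>t. exp (- c * t))" "(LBINT t:{0<..}. exp (- c * t)) = 1 / c"
    using c by (simp_all add: set_integrable_def set_lebesgue_integral_def has_bochner_integral_iff)
qed

text \<open>Apart from the discount \<open>exp (- lam * t)\<close> this is the density of the first
  time at which Brownian motion with generator the Laplacian, started at distance \<open>a\<close>,
  hits the boundary. The factor a/t comes from the normal derivative of the reflected
  kernel.\<close>

definition poisson_weight :: "real \<Rightarrow> real \<Rightarrow> real \<Rightarrow> real" where
  "poisson_weight lam a t = exp (- lam * t) * (a / t) * heat_kernel t a"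

definition heat_mixture :: "(real \<Rightarrow> real) \<Rightarrow> 'a::euclidean_space \<Rightarrow> real" where
  "heat_mixture \<rho> y = (LBINT t:{0<..}. \<rho> t * heat_kernel t y)"

text \<open>The kernel vanishes at the boundary point, so the derivative falls on the factor 1 -
  exp(-x0 s/t) alone, while the Gaussian factor merely converges.\<close>

lemma difference_quotient_half_space_kernel:
  fixes x :: "real \<times> 'a::euclidean_space"
  assumes t: "t > 0" and X: "X \<longlonglongrightarrow> 0" "\<And>n. X n > 0"
  shows "(\<lambda>n. half_space_kernel t x (X n, y) / X n) \<longlonglongrightarrow> fst x / t * heat_kernel t (x - (0, y))"
proof -
  have "((\<lambda>s. 1 - exp (- (fst x * s / t))) has_real_derivative fst x / t) (at 0)"
    using t by (auto intro!: derivative_eq_intros)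
  then have "((\<lambda>s. (1 - exp (- (fst x * s / t))) / s) \<longlongrightarrow> fst x / t) (at 0)"
    by (simp add: has_field_derivative_iff)
  moreover have "filterlim X (at 0) sequentially"
    using X(1) less_imp_neq[OF X(2), symmetric] by (simp add: filterlim_at)
  ultimately have "(\<lambda>n. (1 - exp (- (fst x * X n / t))) / X n) \<longlonglongrightarrow> fst x / t"
    by (rule filterlim_compose)
  moreover have "(\<lambda>n. heat_kernel t (x - (X n, y))) \<longlonglongrightarrow> heat_kernel t (x - (0, y))"
    unfolding heat_kernel_def using t by (intro tendsto_intros X(1)) auto
  ultimately have "(\<lambda>n. (1 - exp (- (fst x * X n / t))) / X n * heat_kernel t (x - (X n, y)))
      \<longlonglongrightarrow> fst x / t * heat_kernel t (x - (0, y))"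
    by (rule tendsto_mult)
  then show ?thesis
    by (simp add: half_space_kernel_eq[OF t] mult.commute)
qed

text \<open>The normal derivative is taken under the time integral, along sequences. The majorant is
  a multiple of e^(-lam t): for steps of at most \<open>fst x / 2\<close> the source stays at
  distance at least \<open>fst x / 2\<close>, so the Gaussian is at most a constant times t, which
  cancels the 1/t coming from the bound \<open>min 1 (fst x * X n / t)\<close>.\<close>

lemma boundary_kernel_eq:
  fixes G :: "real \<Rightarrow> real \<times> (real ^ 'm) \<Rightarrow> real \<times> (real ^ 'm) \<Rightarrow> real"
  assumes lam: "lam > 0" and G: "dirichlet_heat_kernel half_space G" and x: "x \<in> half_space"
  shows "boundary_kernel lam G x = (\<lambda>y. heat_mixture (poisson_weight lam (fst x)) (y - snd x))"
proof
  fix y :: "real ^ 'm"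
  have x0: "fst x > 0" using x by (auto simp: half_space_def)
  define R where "R s = resolvent_kernel lam G x ((0, y) + s *\<^sub>R (1, 0))" for s
  define P where "P = heat_mixture (poisson_weight lam (fst x)) (y - snd x)"
  have R: "R s = (LBINT t:{0<..}. exp (- lam * t) * half_space_kernel t x (s, y))" if "s \<ge> 0" for s
    unfolding R_def resolvent_kernel_def
    by (intro set_lebesgue_integral_cong)
      (use that in \<open>auto simp: closure_half_space dirichlet_heat_kernel_half_space_eq[OF G _ x]\<close>)
  \<comment> \<open>The resolvent kernel vanishes on the boundary, so its difference quotient is
    just \<open>R s / s\<close>.\<close>
  have R0: "R 0 = 0" using R[of 0] by (simp add: set_lebesgue_integral_def)
  have "fst x / 2 > 0" using x0 by simp
  then obtain C where C: "C > 0"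
    "\<And>t w :: real \<times> (real ^ 'm). t > 0 \<Longrightarrow> fst x / 2 \<le> norm w \<Longrightarrow> heat_kernel t w \<le> C * t"
    using heat_kernel_off_diagonal by blast
  have kernel: "heat_kernel t (x - (0, y)) = heat_kernel t (fst x) * heat_kernel t (y - snd x)" if "t > 0" for t
    using heat_kernel_Pair[OF that, of "fst x" "snd x - y"] heat_kernel_minus[of t "snd x - y"]
    by (simp add: minus_prod_def)
  have lim: "(\<lambda>n. R (X n) / X n) \<longlonglongrightarrow> P" if X: "X \<longlonglongrightarrow> 0" "\<And>n. X n > 0" "\<And>n. X n \<le> fst x / 2" for X
  proof -
    have "(\<lambda>n. LINT t|lborel. indicator {0<..} t * (exp (- lam * t) * (half_space_kernel t x (X n, y) / X n))) \<longlonglongrightarrow>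
      (LINT t|lborel. indicator {0<..} t * (poisson_weight lam (fst x) t * heat_kernel t (y - snd x)))"
    proof (rule integral_dominated_convergence)
      show "integrable lborel (\<lambda>t. C * fst x * (indicator {0<..} t *\<^sub>R exp (- lam * t)))"
        using set_integrable_exp[OF lam] unfolding set_integrable_def by (intro integrable_mult_right)
      show "AE t in lborel. (\<lambda>n. indicator {0<..} t * (exp (- lam * t) * (half_space_kernel t x (X n, y) / X n))) \<longlonglongrightarrow>
         indicator {0<..} t * (poisson_weight lam (fst x) t * heat_kernel t (y - snd x))"
      proof (rule AE_I2)
        fix t :: real
        show "(\<lambda>n. indicator {0<..} t * (exp (- lam * t) * (half_space_kernel t x (X n, y) / X n))) \<longlonglongrightarrow>
         indicator {0<..} t * (poisson_weight lam (fst x) t * heat_kernel t (y - snd x))"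
        proof (cases "t > 0")
          case True
          have "(\<lambda>n. exp (- lam * t) * (half_space_kernel t x (X n, y) / X n)) \<longlonglongrightarrow>
            exp (- lam * t) * (fst x / t * heat_kernel t (x - (0, y)))"
            by (intro tendsto_intros difference_quotient_half_space_kernel True X)
          then show ?thesis using True by (simp add: poisson_weight_def kernel mult_ac)
        qed simp
      qed
      fix n
      show "(\<lambda>t. indicator {0<..} t * (exp (- lam * t) * (half_space_kernel t x (X n, y) / X n))) \<in> borel_measurable lborel"
        unfolding half_space_kernel_def by measurable
      show "AE t in lborel. norm (indicator {0<..} t * (exp (- lam * t) * (half_space_kernel t x (X n, y) / X n)))
          \<le> C * fst x * (indicator {0<..} t *\<^sub>R exp (- lam * t))"
      proof (rule AE_I2)
        fix t :: real
        show "norm (indicator {0<..} t * (exp (- lam * t) * (half_space_kernel t x (X n, y) / X n)))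
          \<le> C * fst x * (indicator {0<..} t *\<^sub>R exp (- lam * t))"
        proof (cases "t > 0")
          case True
          have "fst x / 2 \<le> \<bar>fst (x - (X n, y))\<bar>" using X(2,3)[of n] x0 by auto
          also have "\<dots> \<le> norm (x - (X n, y))"
            by (rule abs_fst_le_norm)
          finally have h: "heat_kernel t (x - (X n, y)) \<le> C * t" using C(2) True by blast
          have k: "0 \<le> half_space_kernel t x (X n, y)"
            "half_space_kernel t x (X n, y) \<le> heat_kernel t (x - (X n, y)) * min 1 (fst x * X n / t)"
            using half_space_kernel_bounds[OF True, of x "(X n, y)"] x0 X(2)[of n] by auto
          note k(2)
          also have "heat_kernel t (x - (X n, y)) * min 1 (fst x * X n / t) \<le> C * t * (fst x * X n / t)"
            using h C(1) True x0 X(2)[of n] by (intro mult_mono heat_kernel_nonneg) auto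
          also have "\<dots> = C * fst x * X n" using True by simp
          finally have "half_space_kernel t x (X n, y) / X n \<le> C * fst x"
            using X(2)[of n] by (simp add: field_simps)
          then have "exp (- lam * t) * (half_space_kernel t x (X n, y) / X n) \<le> exp (- lam * t) * (C * fst x)"
            by (intro mult_left_mono) auto
          then show ?thesis using True k(1) X(2)[of n] by (simp add: mult_ac)
        qed simp
      qed
    qed (simp add: poisson_weight_def)
    moreover have "R (X n) / X n = (LINT t|lborel. indicator {0<..} t * (exp (- lam * t) * (half_space_kernel t x (X n, y) / X n)))" for n
      using R[of "X n"] X(2)[of n] by (simp add: set_lebesgue_integral_def less_imp_le flip: Bochner_Integration.integral_divide_zero)
    ultimately show ?thesis
      using less_imp_neq[OF X(2), symmetric]
      by (simp add: P_def heat_mixture_def set_lebesgue_integral_def)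
  qed
  have "((\<lambda>s. R s / s) \<longlongrightarrow> P) (at 0 within {0<..fst x / 2})"
    unfolding tendsto_at_iff_sequentially
  proof (intro allI impI)
    fix X :: "nat \<Rightarrow> real" assume "\<forall>i. X i \<in> {0<..fst x / 2} - {0}" "X \<longlonglongrightarrow> 0"
    then show "((\<lambda>s. R s / s) \<circ> X) \<longlonglongrightarrow> P"
      using lim[of X] by (simp add: o_def)
  qed
  \<comment> \<open>Only small positive steps matter for the limit, so the bound on the step size
    does not change the filter.\<close>
  moreover have "at 0 within {0<..fst x / 2} = at 0 within {0..}"
    by (rule at_within_nhd[of _ "{..<fst x / 2}"]) (use x0 in auto)
  ultimately have "(R has_vector_derivative P) (at 0 within {0..})"
    unfolding has_real_derivative_iff_has_vector_derivative[symmetric] has_field_derivative_iff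
    by (simp add: R0)
  then have "vector_derivative R (at 0 within {0..}) = P"
    by (intro vector_derivative_within) (simp_all add: at_within_Ici_at_right)
  then show "boundary_kernel lam G x y = heat_mixture (poisson_weight lam (fst x)) (y - snd x)"
    unfolding boundary_kernel_def R_def[symmetric, abs_def] P_def .
qed

subsection \<open>Mixtures of Gaussians are Schwartz functions\<close>

text \<open>Every real order is required: negative orders compensate the singularity of the Gaussian
  at time 0 and the 1/t gained with each derivative, positive orders the powers of t that appear
  when decay in space is traded for growth in time.\<close>

definition rapid_weight :: "(real \<Rightarrow> real) \<Rightarrow> bool" where
  "rapid_weight \<rho> \<longleftrightarrow> (\<forall>q. set_integrable lborel {0<..} (\<lambda>t. t powr q * \<rho> t))"

lemma rapid_weight_integrable:
  "rapid_weight \<rho> \<Longrightarrow> set_integrable lborel {0<..} (\<lambda>t. t powr q * \<rho> t)"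
  by (simp add: rapid_weight_def)

lemma rapid_weight_abs_integrable:
  assumes "rapid_weight \<rho>"
  shows "set_integrable lborel {0<..} (\<lambda>t. t powr q * \<bar>\<rho> t\<bar>)"
  using set_integrable_abs[OF rapid_weight_integrable[OF assms, of q]] by (simp add: abs_mult)

lemma rapid_weight_divide:
  assumes "rapid_weight \<rho>"
  shows "rapid_weight (\<lambda>t. \<rho> t / t)"
  unfolding rapid_weight_def
proof
  fix q
  have "set_integrable lborel {0<..} (\<lambda>t. t powr (q - 1) * \<rho> t)"
    by (rule rapid_weight_integrable[OF assms])
  also have "?this \<longleftrightarrow> set_integrable lborel {0<..} (\<lambda>t. t powr q * (\<rho> t / t))"
    by (intro set_integrable_cong) (auto simp: powr_diff)
  finally show "set_integrable lborel {0<..} (\<lambda>t. t powr q * (\<rho> t / t))" .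
qed

lemma rapid_weight_measurable:
  assumes "rapid_weight \<rho>"
  shows "(\<lambda>t. indicator {0<..} t * \<rho> t) \<in> borel_measurable borel"
proof -
  have "(\<lambda>t. indicator {0<..} t *\<^sub>R (t powr 0 * \<rho> t)) \<in> borel_measurable borel"
    using rapid_weight_integrable[OF assms, of 0] unfolding set_integrable_def
    by (auto dest: borel_measurable_integrable)
  also have "(\<lambda>t. indicator {0<..} t *\<^sub>R (t powr 0 * \<rho> t)) = (\<lambda>t. indicator {0<..} t * \<rho> t)"
    by (auto simp: indicator_def fun_eq_iff)
  finally show ?thesis .
qed

lemma heat_kernel_bound_powr:
  fixes y :: "'a::euclidean_space"
  assumes "t > 0"
  shows "heat_kernel t y \<le> t powr (- real DIM('a) / 2)"
proof -
  have "heat_kernel t y \<le> (4 * pi * t) powr (- real DIM('a) / 2)"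
    using assms by (intro heat_kernel_le) auto
  also have "\<dots> \<le> t powr (- real DIM('a) / 2)"
    using assms pi_gt3 by (intro powr_mono2') auto
  finally show ?thesis .
qed

lemma set_integrable_heat_mixture:
  fixes y :: "'a::euclidean_space"
  assumes "rapid_weight \<rho>"
  shows "set_integrable lborel {0<..} (\<lambda>t. \<rho> t * heat_kernel t y)"
  unfolding set_integrable_def
proof (rule Bochner_Integration.integrable_bound)
  have [measurable]: "(\<lambda>t. indicator {0<..} t * \<rho> t) \<in> borel_measurable borel"
    by (rule rapid_weight_measurable[OF assms])
  have "(\<lambda>t. (indicator {0<..} t * \<rho> t) * heat_kernel t y) \<in> borel_measurable borel"
    by measurable
  then show "(\<lambda>t. indicator {0<..} t *\<^sub>R (\<rho> t * heat_kernel t y)) \<in> borel_measurable lborel"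
    by (simp add: mult.assoc)
  show "integrable lborel (\<lambda>t. indicator {0<..} t *\<^sub>R (t powr (- real DIM('a) / 2) * \<bar>\<rho> t\<bar>))"
    using rapid_weight_abs_integrable[OF assms] unfolding set_integrable_def .
  show "AE t in lborel. norm (indicator {0<..} t *\<^sub>R (\<rho> t * heat_kernel t y))
      \<le> norm (indicator {0<..} t *\<^sub>R (t powr (- real DIM('a) / 2) * \<bar>\<rho> t\<bar>))"
    by (intro AE_I2)
      (use heat_kernel_bound_powr[of _ y] in \<open>auto simp: indicator_def abs_mult heat_kernel_nonneg
        mult.commute[of "_ powr _"] intro!: mult_left_mono\<close>)
qed

text \<open>The quadratic remainder is integrable against \<open>\<rho>\<close>, which replaces differentiation under the
  integral sign.\<close>

lemma heat_kernel_taylor: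
  fixes w h :: "'a::euclidean_space"
  assumes t: "t > 0"
  shows "\<bar>heat_kernel t (w + h) - heat_kernel t w + (w \<bullet> h) / (2 * t) * heat_kernel t w\<bar>
    \<le> t powr (- real DIM('a) / 2 - 1) * (norm h)\<^sup>2"
proof -
  define W where "W r = w + r *\<^sub>R h" for r :: real
  define f where "f r = heat_kernel t (W r)" for r
  define f1 where "f1 r = - (W r \<bullet> h) / (2 * t) * heat_kernel t (W r)" for r
  define f2 where "f2 r = (- (norm h)\<^sup>2 / (2 * t) + (W r \<bullet> h)\<^sup>2 / (4 * t\<^sup>2)) * heat_kernel t (W r)" for r
  have W: "(W has_derivative (\<lambda>q. q *\<^sub>R h)) (at r)" for r
    unfolding W_def[abs_def] by (auto intro!: derivative_eq_intros)
  have Wh: "((\<lambda>r. W r \<bullet> h) has_real_derivative (norm h)\<^sup>2) (at r)" for r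
  proof -
    have "((\<lambda>r. w \<bullet> h + r * (norm h)\<^sup>2) has_real_derivative (norm h)\<^sup>2) (at r)"
      by (auto intro!: derivative_eq_intros)
    then show ?thesis by (simp add: W_def inner_add_left power2_norm_eq_inner)
  qed
  have f: "(f has_real_derivative f1 r) (at r)" for r
    using has_derivative_compose[OF W has_derivative_heat_kernel[OF t]]
    unfolding has_field_derivative_def f_def[abs_def] f1_def
    by (rule has_derivative_eq_rhs) (auto simp: fun_eq_iff)
  have f1: "(f1 has_real_derivative f2 r) (at r)" for r
  proof -
    have "((\<lambda>r. - (W r \<bullet> h) / (2 * t)) has_real_derivative - (norm h)\<^sup>2 / (2 * t)) (at r)"
      by (intro DERIV_cdivide DERIV_minus Wh)
    from DERIV_mult[OF this f] show ?thesis
      unfolding f1_def[abs_def] f_def f2_def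
      by (rule DERIV_cong) (simp add: f1_def algebra_simps power2_eq_square)
  qed
  define d where "d = (\<lambda>m::nat. if m = 0 then f else if m = 1 then f1 else f2)"
  have "\<exists>r::real. 0 < r \<and> r < 1 \<and>
      f 1 = sum (\<lambda>m. (d m 0 / fact m) * 1 ^ m) {..<2} + (d 2 r / fact 2) * 1 ^ 2"
    by (rule Maclaurin) (use f f1 in \<open>auto simp: d_def less_2_cases_iff\<close>)
  then obtain r where r: "f 1 = f 0 + f1 0 + f2 r / 2"
    by (auto simp: d_def numeral_2_eq_2)
  \<comment> \<open>\<open>f2 r\<close> has to be bounded independently of \<open>w\<close>. The
    growing factor is absorbed by u <= exp u at u = |W r|^2/(4t), and this exponential cancels the
    one in the kernel, leaving its prefactor.\<close>
  have "(W r \<bullet> h)\<^sup>2 \<le> (norm (W r))\<^sup>2 * (norm h)\<^sup>2"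
    using power_mono[OF Cauchy_Schwarz_ineq2[of "W r" h], of 2] by (simp add: power_mult_distrib)
  then have "(W r \<bullet> h)\<^sup>2 / (4 * t\<^sup>2) \<le> (norm (W r))\<^sup>2 * (norm h)\<^sup>2 / (4 * t\<^sup>2)"
    by (intro divide_right_mono) auto
  also have "\<dots> = (norm (W r))\<^sup>2 / (4 * t) * ((norm h)\<^sup>2 / t)"
    by (simp add: power2_eq_square)
  also have "\<dots> \<le> exp ((norm (W r))\<^sup>2 / (4 * t)) * ((norm h)\<^sup>2 / t)"
    using power_le_fact_exp[of "(norm (W r))\<^sup>2 / (4 * t)" 1] t by (intro mult_right_mono) auto
  finally have a: "(W r \<bullet> h)\<^sup>2 / (4 * t\<^sup>2) \<le> exp ((norm (W r))\<^sup>2 / (4 * t)) * ((norm h)\<^sup>2 / t)" .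
  have b: "exp ((norm (W r))\<^sup>2 / (4 * t)) * heat_kernel t (W r) = (4 * pi * t) powr (- real DIM('a) / 2)"
    by (simp add: heat_kernel_def exp_minus)
  also have "\<dots> \<le> t powr (- real DIM('a) / 2)"
    using t pi_gt3 by (intro powr_mono2') auto
  finally have b: "exp ((norm (W r))\<^sup>2 / (4 * t)) * heat_kernel t (W r) \<le> t powr (- real DIM('a) / 2)" .
  have "\<bar>f2 r\<bar> \<le> ((norm h)\<^sup>2 / (2 * t) + (W r \<bullet> h)\<^sup>2 / (4 * t\<^sup>2)) * heat_kernel t (W r)"
    unfolding f2_def abs_mult using t
    by (intro mult_mono) (auto intro!: abs_leI simp: heat_kernel_nonneg)
  also have "\<dots> \<le> ((norm h)\<^sup>2 / t + exp ((norm (W r))\<^sup>2 / (4 * t)) * ((norm h)\<^sup>2 / t)) * heat_kernel t (W r)"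
    using a t by (intro mult_right_mono add_mono heat_kernel_nonneg) (auto intro!: divide_left_mono)
  also have "\<dots> = (heat_kernel t (W r) + exp ((norm (W r))\<^sup>2 / (4 * t)) * heat_kernel t (W r)) * ((norm h)\<^sup>2 / t)"
    by (simp add: algebra_simps)
  also have "\<dots> \<le> (t powr (- real DIM('a) / 2) + t powr (- real DIM('a) / 2)) * ((norm h)\<^sup>2 / t)"
    using b heat_kernel_bound_powr[OF t, of "W r"] t by (intro mult_right_mono add_mono) auto
  also have "\<dots> = 2 * (t powr (- real DIM('a) / 2 - 1) * (norm h)\<^sup>2)"
    using t by (simp add: powr_diff)
  finally have "\<bar>f2 r / 2\<bar> \<le> t powr (- real DIM('a) / 2 - 1) * (norm h)\<^sup>2" by simp
  moreover have "f2 r / 2 = heat_kernel t (w + h) - heat_kernel t w + (w \<bullet> h) / (2 * t) * heat_kernel t w"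
    using r by (simp add: f_def f1_def W_def)
  ultimately show ?thesis by simp
qed

text \<open>The gradient of the Gaussian is -y/(2t) times the Gaussian, which explains the weight
  \<open>\<rho> t / t\<close>. Integrating the Taylor bound gives an error of at most
  \<open>J\<close> times |h|^2, where \<open>J\<close> is a finite absolute moment of
  \<open>\<rho>\<close>.\<close>

lemma has_derivative_heat_mixture:
  fixes y :: "'a::euclidean_space"
  assumes \<rho>: "rapid_weight \<rho>"
  shows "(heat_mixture \<rho> has_derivative (\<lambda>h. - (1 / 2) * ((y \<bullet> h) * heat_mixture (\<lambda>t. \<rho> t / t) y))) (at y)"
proof (rule has_derivativeI_sandwich[of 1])
  define q where "q = - real DIM('a) / 2 - 1"
  define J where "J = (LBINT t:{0<..}. t powr q * \<bar>\<rho> t\<bar>)"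
  show "bounded_linear (\<lambda>h. - (1 / 2) * ((y \<bullet> h) * heat_mixture (\<lambda>t. \<rho> t / t) y))"
    by (intro bounded_linear_const_mult bounded_linear_mult_const bounded_linear_inner_right)
  have "((\<lambda>z. J * norm (z - y)) \<longlongrightarrow> J * norm (y - y)) (at y)"
    by (intro tendsto_intros)
  then show "((\<lambda>z. J * norm (z - y)) \<longlongrightarrow> 0) (at y)" by simp
  fix z :: 'a assume "z \<noteq> y"
  define h where "h = z - y"
  have i: "set_integrable lborel {0<..} (\<lambda>t. \<rho> t * heat_kernel t w)"
    "set_integrable lborel {0<..} (\<lambda>t. \<rho> t / t * heat_kernel t w)" for w :: 'a
    using set_integrable_heat_mixture[OF \<rho>] set_integrable_heat_mixture[OF rapid_weight_divide[OF \<rho>]] by auto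
  have "heat_mixture \<rho> z - heat_mixture \<rho> y - - (1 / 2) * ((y \<bullet> h) * heat_mixture (\<lambda>t. \<rho> t / t) y) =
    (LBINT t:{0<..}. \<rho> t * heat_kernel t z) - (LBINT t:{0<..}. \<rho> t * heat_kernel t y) +
    (LBINT t:{0<..}. (y \<bullet> h) / 2 * (\<rho> t / t * heat_kernel t y))"
    unfolding set_integral_mult_right by (simp add: heat_mixture_def)
  also have "\<dots> = (LBINT t:{0<..}. (\<rho> t * heat_kernel t z - \<rho> t * heat_kernel t y) + (y \<bullet> h) / 2 * (\<rho> t / t * heat_kernel t y))"
  proof -
    have "(LBINT t:{0<..}. \<rho> t * heat_kernel t z) - (LBINT t:{0<..}. \<rho> t * heat_kernel t y) =
      (LBINT t:{0<..}. \<rho> t * heat_kernel t z - \<rho> t * heat_kernel t y)"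
      by (rule set_integral_diff(2)[symmetric]) (rule i)+
    then show ?thesis
      by (simp only:) (intro set_integral_add(2)[symmetric] set_integral_diff(1) set_integrable_mult_right i)
  qed
  finally have eq: "heat_mixture \<rho> z - heat_mixture \<rho> y - - (1 / 2) * ((y \<bullet> h) * heat_mixture (\<lambda>t. \<rho> t / t) y) =
    (LBINT t:{0<..}. (\<rho> t * heat_kernel t z - \<rho> t * heat_kernel t y) + (y \<bullet> h) / 2 * (\<rho> t / t * heat_kernel t y))"
    (is "?L = (LBINT t:{0<..}. ?f t)") .
  have "\<bar>LBINT t:{0<..}. ?f t\<bar> \<le> (LBINT t:{0<..}. (norm h)\<^sup>2 * (t powr q * \<bar>\<rho> t\<bar>))"
    unfolding set_lebesgue_integral_def
  proof (rule integral_abs_bound_integral)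
    show "integrable lborel (\<lambda>t. indicator {0<..} t *\<^sub>R ?f t)"
      using set_integral_add(1)[OF set_integral_diff(1)[OF i(1)[of z] i(1)[of y]] set_integrable_mult_right[OF i(2)[of y]]]
      unfolding set_integrable_def by blast
    show "integrable lborel (\<lambda>t. indicator {0<..} t *\<^sub>R ((norm h)\<^sup>2 * (t powr q * \<bar>\<rho> t\<bar>)))"
      using set_integrable_mult_right[OF rapid_weight_abs_integrable[OF \<rho>, of q], of "(norm h)\<^sup>2"]
      unfolding set_integrable_def by blast
    fix t :: real
    show "\<bar>indicator {0<..} t *\<^sub>R ?f t\<bar> \<le> indicator {0<..} t *\<^sub>R ((norm h)\<^sup>2 * (t powr q * \<bar>\<rho> t\<bar>))"
    proof (cases "t > 0")
      case True
      have "?f t = \<rho> t * (heat_kernel t (y + h) - heat_kernel t y + (y \<bullet> h) / (2 * t) * heat_kernel t y)"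
        by (simp add: h_def algebra_simps)
      also have "\<bar>\<dots>\<bar> \<le> \<bar>\<rho> t\<bar> * (t powr q * (norm h)\<^sup>2)"
        unfolding abs_mult q_def using heat_kernel_taylor[OF True, of y h] by (intro mult_left_mono) auto
      finally show ?thesis using True by (simp add: mult_ac)
    qed simp
  qed
  also have "\<dots> = J * norm h * norm h"
    by (simp add: J_def power2_eq_square)
  finally have "\<bar>?L\<bar> / norm h \<le> J * norm h"
    using \<open>z \<noteq> y\<close> unfolding eq by (subst pos_divide_le_eq) (auto simp: h_def)
  then show "norm (heat_mixture \<rho> z - heat_mixture \<rho> y - - (1 / 2) * ((y \<bullet> (z - y)) * heat_mixture (\<lambda>t. \<rho> t / t) y))
      / norm (z - y) \<le> J * norm (z - y)"
    by (simp only: h_def real_norm_def)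
qed simp

text \<open>A power of |y| is converted into a power of time: |y|^(2k) is at most k! (4t)^k
  exp(|y|^2/(4t)), and that exponential cancels the one in the Gaussian. What remains are moments of
  |\<rho>| that do not depend on \<open>y\<close>.\<close>

lemma heat_mixture_decay:
  assumes \<rho>: "rapid_weight \<rho>"
  shows "\<exists>C. \<forall>y::'a::euclidean_space. (1 + norm y) ^ k * \<bar>heat_mixture \<rho> y\<bar> \<le> C"
proof (intro exI allI)
  fix y :: 'a
  define N where "N = - real DIM('a) / 2"
  let ?B = "\<lambda>t::real. 2 ^ k * (t powr N * \<bar>\<rho> t\<bar> + 4 ^ k * fact k * (t powr (real k + N) * \<bar>\<rho> t\<bar>))"
  \<comment> \<open>Even exponents are wanted, because the Gaussian contains the square of the
    norm.\<close>
  have p: "(1 + norm y) ^ k \<le> 2 ^ k * (1 + norm y ^ (2 * k))"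
  proof -
    have "(1 + norm y) ^ k \<le> (2 * max 1 (norm y)) ^ k" by (intro power_mono) auto
    also have "\<dots> = 2 ^ k * max 1 (norm y) ^ k" by (simp add: power_mult_distrib)
    also have "max 1 (norm y) ^ k \<le> 1 + norm y ^ (2 * k)"
    proof (cases "norm y \<le> 1")
      case False
      then have "norm y ^ k \<le> norm y ^ (2 * k)" by (intro power_increasing) auto
      moreover have "max 1 (norm y) = norm y" using False by simp
      ultimately show ?thesis by linarith
    qed (simp add: max_def)
    finally show ?thesis by simp
  qed
  have "(1 + norm y) ^ k * \<bar>heat_mixture \<rho> y\<bar> = \<bar>LBINT t:{0<..}. (1 + norm y) ^ k * (\<rho> t * heat_kernel t y)\<bar>"
    by (simp add: heat_mixture_def abs_mult)
  also have "\<dots> \<le> (LBINT t:{0<..}. ?B t)"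
    unfolding set_lebesgue_integral_def
  proof (rule integral_abs_bound_integral)
    show "integrable lborel (\<lambda>t. indicator {0<..} t *\<^sub>R ((1 + norm y) ^ k * (\<rho> t * heat_kernel t y)))"
      using set_integrable_mult_right[OF set_integrable_heat_mixture[OF \<rho>, of y]] unfolding set_integrable_def by blast
    show "integrable lborel (\<lambda>t. indicator {0<..} t *\<^sub>R ?B t)"
      using set_integrable_mult_right[OF set_integral_add(1)[OF rapid_weight_abs_integrable[OF \<rho>, of N]
            set_integrable_mult_right[OF rapid_weight_abs_integrable[OF \<rho>, of "real k + N"], of "4 ^ k * fact k"]], of "2 ^ k"]
      unfolding set_integrable_def by blast
    fix t :: real
    show "\<bar>indicator {0<..} t *\<^sub>R ((1 + norm y) ^ k * (\<rho> t * heat_kernel t y))\<bar> \<le> indicator {0<..} t *\<^sub>R ?B t"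
    proof (cases "t > 0")
      case True
      have c: "(4 * pi * t) powr N \<le> t powr N"
        using True pi_gt3 unfolding N_def by (intro powr_mono2') auto
      define E where "E = exp ((norm y)\<^sup>2 / (4 * t))"
      have E: "E > 0" "E * heat_kernel t y = (4 * pi * t) powr N"
        by (simp_all add: E_def heat_kernel_def N_def exp_minus)
      have "norm y ^ (2 * k) = (4 * t) ^ k * ((norm y)\<^sup>2 / (4 * t)) ^ k"
        using True by (simp add: power_mult power_divide)
      also have "\<dots> \<le> (4 * t) ^ k * (fact k * E)"
        unfolding E_def using True by (intro mult_left_mono power_le_fact_exp) auto
      finally have "norm y ^ (2 * k) * heat_kernel t y \<le> (4 * t) ^ k * (fact k * E) * heat_kernel t y"
        by (intro mult_right_mono heat_kernel_nonneg)
      also have "\<dots> = 4 ^ k * fact k * (t ^ k * (4 * pi * t) powr N)"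
        unfolding E(2)[symmetric] by (simp add: power_mult_distrib)
      also have "\<dots> \<le> 4 ^ k * fact k * (t ^ k * t powr N)"
        using c True by (intro mult_left_mono) auto
      also have "t ^ k * t powr N = t powr (real k + N)"
        using True by (simp add: powr_add powr_realpow)
      finally have 1: "norm y ^ (2 * k) * heat_kernel t y \<le> 4 ^ k * fact k * t powr (real k + N)" .
      have 2: "heat_kernel t y \<le> t powr N"
        using heat_kernel_bound_powr[OF True, of y] by (simp add: N_def)
      have "(1 + norm y) ^ k * heat_kernel t y \<le> 2 ^ k * (1 + norm y ^ (2 * k)) * heat_kernel t y"
        using p by (intro mult_right_mono heat_kernel_nonneg)
      also have "\<dots> = 2 ^ k * (heat_kernel t y + norm y ^ (2 * k) * heat_kernel t y)"
        by (simp add: algebra_simps)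
      also have "\<dots> \<le> 2 ^ k * (t powr N + 4 ^ k * fact k * t powr (real k + N))"
        using 1 2 by (intro mult_left_mono add_mono) auto
      finally have "\<bar>\<rho> t\<bar> * ((1 + norm y) ^ k * heat_kernel t y) \<le> \<bar>\<rho> t\<bar> * (2 ^ k * (t powr N + 4 ^ k * fact k * t powr (real k + N)))"
        by (intro mult_left_mono) auto
      then show ?thesis
        using True by (simp add: abs_mult heat_kernel_nonneg algebra_simps)
    qed simp
  qed
  finally show "(1 + norm y) ^ k * \<bar>heat_mixture \<rho> y\<bar> \<le> (LBINT t:{0<..}. ?B t)" .
qed

text \<open>A class closed under differentiation that contains the boundary kernel; differentiating a mixture
  replaces the weight \<open>\<rho>(t)\<close> by \<open>\<rho>(t) / t\<close>.\<close>

inductive_set polynomial_mixtures :: "'a::euclidean_space \<Rightarrow> ('a \<Rightarrow> real) set" for p :: 'a where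
  mixture: "rapid_weight \<rho> \<Longrightarrow> (\<lambda>y. heat_mixture \<rho> (y - p)) \<in> polynomial_mixtures p"
| coordinate: "f \<in> polynomial_mixtures p \<Longrightarrow> (\<lambda>y. ((y - p) \<bullet> b) * f y) \<in> polynomial_mixtures p"
| scale: "f \<in> polynomial_mixtures p \<Longrightarrow> (\<lambda>y. c * f y) \<in> polynomial_mixtures p"
| add: "f \<in> polynomial_mixtures p \<Longrightarrow> g \<in> polynomial_mixtures p \<Longrightarrow> (\<lambda>y. f y + g y) \<in> polynomial_mixtures p"

lemma polynomial_mixtures_derivative:
  assumes "f \<in> polynomial_mixtures p"
  shows "\<exists>D. (\<forall>y. (f has_derivative D y) (at y)) \<and> (\<forall>b. (\<lambda>y. D y b) \<in> polynomial_mixtures p)"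
  using assms
proof induction
  case (mixture \<rho>)
  define D where "D = (\<lambda>y h. - (1 / 2) * (((y - p) \<bullet> h) * heat_mixture (\<lambda>t. \<rho> t / t) (y - p)))"
  have "((\<lambda>y. heat_mixture \<rho> (y - p)) has_derivative D y) (at y)" for y
  proof -
    have "((\<lambda>y. y - p) has_derivative (\<lambda>h. h)) (at y)" by (auto intro!: derivative_eq_intros)
    from has_derivative_compose[OF this has_derivative_heat_mixture[OF mixture]]
    show ?thesis by (simp add: D_def)
  qed
  moreover have "(\<lambda>y. D y b) \<in> polynomial_mixtures p" for b
    unfolding D_def by (intro polynomial_mixtures.intros rapid_weight_divide mixture)
  ultimately show ?case by blast
next
  case (coordinate f b)
  then obtain D where D: "\<And>y. (f has_derivative D y) (at y)" "\<And>h. (\<lambda>y. D y h) \<in> polynomial_mixtures p" by blast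
  have "((\<lambda>y. ((y - p) \<bullet> b) * f y) has_derivative (\<lambda>h. (h \<bullet> b) * f y + ((y - p) \<bullet> b) * D y h)) (at y)" for y
    by (auto intro!: derivative_eq_intros D(1) simp: fun_eq_iff)
  moreover have "(\<lambda>y. (h \<bullet> b) * f y + ((y - p) \<bullet> b) * D y h) \<in> polynomial_mixtures p" for h
    by (intro polynomial_mixtures.intros D coordinate)
  ultimately show ?case by (intro exI[of _ "\<lambda>y h. (h \<bullet> b) * f y + ((y - p) \<bullet> b) * D y h"]) blast
next
  case (scale f c)
  then obtain D where D: "\<And>y. (f has_derivative D y) (at y)" "\<And>h. (\<lambda>y. D y h) \<in> polynomial_mixtures p" by blast
  then show ?case
    by (intro exI[of _ "\<lambda>y h. c * D y h"]) (auto intro: has_derivative_mult_right polynomial_mixtures.intros)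
next
  case (add f g)
  then obtain D E where D: "\<And>y. (f has_derivative D y) (at y)" "\<And>h. (\<lambda>y. D y h) \<in> polynomial_mixtures p"
    and E: "\<And>y. (g has_derivative E y) (at y)" "\<And>h. (\<lambda>y. E y h) \<in> polynomial_mixtures p" by blast
  then show ?case
    by (intro exI[of _ "\<lambda>y h. D y h + E y h"]) (auto intro: has_derivative_add polynomial_mixtures.intros)
qed

text \<open>The induction runs over all \<open>k\<close> simultaneously because a coordinate factor
  uses up one power of 1 + |y|. Moving the centre to \<open>p\<close> costs a power of 1 +
  |p|.\<close>

lemma polynomial_mixtures_decay:
  assumes "f \<in> polynomial_mixtures p"
  shows "\<exists>C. \<forall>y. (1 + norm y) ^ k * \<bar>f y\<bar> \<le> C"
  using assms
proof (induction arbitrary: k)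
  case (mixture \<rho>)
  obtain C where C: "\<And>y::'a. (1 + norm y) ^ k * \<bar>heat_mixture \<rho> y\<bar> \<le> C"
    using heat_mixture_decay[OF mixture] by blast
  have "(1 + norm y) ^ k * \<bar>heat_mixture \<rho> (y - p)\<bar> \<le> (1 + norm p) ^ k * C" for y
  proof -
    have "1 + norm y \<le> (1 + norm p) * (1 + norm (y - p))"
      using norm_triangle_sub[of y p] mult_nonneg_nonneg[of "norm p" "norm (y - p)"]
      by (simp add: distrib_left distrib_right del: mult_nonneg_nonneg)
    then have "(1 + norm y) ^ k \<le> (1 + norm p) ^ k * (1 + norm (y - p)) ^ k"
      unfolding power_mult_distrib[symmetric] by (intro power_mono) auto
    then have "(1 + norm y) ^ k * \<bar>heat_mixture \<rho> (y - p)\<bar> \<le> (1 + norm p) ^ k * ((1 + norm (y - p)) ^ k * \<bar>heat_mixture \<rho> (y - p)\<bar>)"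
      unfolding mult.assoc[symmetric] by (intro mult_right_mono) auto
    also have "\<dots> \<le> (1 + norm p) ^ k * C" by (intro mult_left_mono C) auto
    finally show ?thesis .
  qed
  then show ?case by blast
next
  case (coordinate f b)
  obtain C where C: "\<And>y. (1 + norm y) ^ Suc k * \<bar>f y\<bar> \<le> C" using coordinate.IH by blast
  have "(1 + norm y) ^ k * \<bar>((y - p) \<bullet> b) * f y\<bar> \<le> (1 + norm p) * norm b * C" for y
  proof -
    have "\<bar>(y - p) \<bullet> b\<bar> \<le> norm (y - p) * norm b" by (rule Cauchy_Schwarz_ineq2)
    also have "norm (y - p) \<le> (1 + norm p) * (1 + norm y)"
      using norm_triangle_ineq4[of y p] mult_nonneg_nonneg[of "norm p" "norm y"]
      by (simp add: distrib_left distrib_right del: mult_nonneg_nonneg)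
    finally have "\<bar>(y - p) \<bullet> b\<bar> \<le> (1 + norm p) * (1 + norm y) * norm b" by (simp add: mult_right_mono)
    then have "(1 + norm y) ^ k * (\<bar>(y - p) \<bullet> b\<bar> * \<bar>f y\<bar>) \<le> (1 + norm y) ^ k * ((1 + norm p) * (1 + norm y) * norm b * \<bar>f y\<bar>)"
      by (intro mult_left_mono mult_right_mono) auto
    also have "\<dots> = (1 + norm p) * norm b * ((1 + norm y) ^ Suc k * \<bar>f y\<bar>)" by simp
    also have "\<dots> \<le> (1 + norm p) * norm b * C" by (intro mult_left_mono C) auto
    finally show ?thesis by (simp add: abs_mult)
  qed
  then show ?case by blast
next
  case (scale f c)
  obtain C where C: "\<And>y. (1 + norm y) ^ k * \<bar>f y\<bar> \<le> C" using scale.IH by blast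
  have "(1 + norm y) ^ k * \<bar>c * f y\<bar> \<le> \<bar>c\<bar> * C" for y
    using mult_left_mono[OF C[of y], of "\<bar>c\<bar>"] by (simp add: abs_mult mult_ac)
  then show ?case by blast
next
  case (add f g)
  obtain C where C: "\<And>y. (1 + norm y) ^ k * \<bar>f y\<bar> \<le> C" using add.IH by blast
  obtain C' where C': "\<And>y. (1 + norm y) ^ k * \<bar>g y\<bar> \<le> C'" using add.IH by blast
  have "(1 + norm y) ^ k * \<bar>f y + g y\<bar> \<le> C + C'" for y
  proof -
    have "(1 + norm y) ^ k * \<bar>f y + g y\<bar> \<le> (1 + norm y) ^ k * (\<bar>f y\<bar> + \<bar>g y\<bar>)"
      by (intro mult_left_mono) auto
    then show ?thesis using C[of y] C'[of y] by (simp add: distrib_left)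
  qed
  then show ?case by blast
qed

lemma polynomial_mixtures_partials:
  assumes "f \<in> polynomial_mixtures p"
  shows "partials bs f \<in> polynomial_mixtures p"
proof (induction bs)
  case (Cons b bs)
  from polynomial_mixtures_derivative[OF this] obtain D where
    D: "\<And>y. (partials bs f has_derivative D y) (at y)" "\<And>h. (\<lambda>y. D y h) \<in> polynomial_mixtures p" by blast
  have "partials (b # bs) f = (\<lambda>y. D y b)"
    using partial_eq[OF D(1)] by (auto simp: fun_eq_iff)
  then show ?case using D(2) by simp
qed (simp add: assms)

lemma polynomial_mixtures_schwartz:
  assumes f: "f \<in> polynomial_mixtures p"
  shows "f \<in> schwartz"
proof -
  have d: "partials bs f differentiable_on UNIV" for bs
    using polynomial_mixtures_derivative[OF polynomial_mixtures_partials[OF f, of bs]]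
    by (auto simp: differentiable_on_def differentiable_def)
  then have "Ck_on k UNIV f" for k
    unfolding Ck_on_def by (auto intro: differentiable_imp_continuous_on)
  moreover have "bounded (range (\<lambda>x. (1 + norm x) ^ k *\<^sub>R partials bs f x))" for k bs
  proof -
    obtain C where "\<And>y. (1 + norm y) ^ k * \<bar>partials bs f y\<bar> \<le> C"
      using polynomial_mixtures_decay[OF polynomial_mixtures_partials[OF f, of bs], of k] by blast
    then show ?thesis
      unfolding bounded_iff by (intro exI[of _ C]) (auto simp: abs_mult)
  qed
  ultimately show ?thesis by (auto simp: schwartz_def)
qed

text \<open>Near 0 the factor exp(-a^2/(4t)) beats every negative power of t; at infinity one half
  of the rate in exp(-lam t) beats every positive power, and the other half stays as the integrable
  majorant.\<close>

lemma rapid_weight_poisson_weight: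
  assumes lam: "lam > 0" and a: "a > 0"
  shows "rapid_weight (poisson_weight lam a)"
  unfolding rapid_weight_def
proof
  fix q :: real
  \<comment> \<open>Collects the exponents of \<open>t\<close>: \<open>q\<close> from the moment, -1
    from \<open>a / t\<close> and -1/2 from the one-dimensional kernel.\<close>
  define r where "r = q - 1 - 1 / 2"
  define c where "c = a * (4 * pi) powr (- (1 / 2))"
  obtain C1 where C1: "C1 > 0" "\<And>t. t > 0 \<Longrightarrow> t powr (- \<bar>r\<bar>) * exp (- (a\<^sup>2 / 4) / t) \<le> C1"
    using powr_exp_inverse_bounded[of "a\<^sup>2 / 4" "\<bar>r\<bar>"] a by auto
  \<comment> \<open>To be applied at \<open>1 / t\<close>, where it controls positive powers of
    \<open>t\<close>.\<close>
  obtain C2 where C2: "C2 > 0" "\<And>t. t > 0 \<Longrightarrow> t powr (- \<bar>r\<bar>) * exp (- (lam / 2) / t) \<le> C2"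
    using powr_exp_inverse_bounded[of "lam / 2" "\<bar>r\<bar>"] lam by auto
  have c: "c \<ge> 0" using a by (simp add: c_def)
  have eq: "t powr q * poisson_weight lam a t = c * (t powr r * exp (- (a\<^sup>2 / 4) / t) * exp (- lam * t))" if "t > 0" for t
  proof -
    have "r = q + - 1 + - (1 / 2)" by (simp add: r_def)
    then have "t powr r = t powr q * t powr (- 1) * t powr (- (1 / 2))"
      by (simp only: powr_add)
    then have A: "t powr q * (1 / t) * t powr (- (1 / 2)) = t powr r"
      using that by (simp add: powr_minus_divide)
    have H: "heat_kernel t a = (4 * pi) powr (- (1 / 2)) * t powr (- (1 / 2)) * exp (- (a\<^sup>2 / 4) / t)"
      using that by (simp add: heat_kernel_def powr_mult)
    show ?thesis
      unfolding poisson_weight_def c_def H A[symmetric] by simp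
  qed
  have bound: "t powr r * exp (- (a\<^sup>2 / 4) / t) * exp (- lam * t) \<le> (C1 + C2) * exp (- (lam / 2) * t)" if t: "t > 0" for t
  proof -
    have e: "exp (- lam * t) = exp (- (lam / 2) * t) * exp (- (lam / 2) * t)"
      unfolding exp_add[symmetric] by (simp add: field_simps)
    have "t powr r * exp (- (a\<^sup>2 / 4) / t) * exp (- (lam / 2) * t) \<le> C1 + C2"
    proof (cases "r \<le> 0")
      case True
      have "t powr r * exp (- (a\<^sup>2 / 4) / t) * exp (- (lam / 2) * t) \<le> C1 * 1"
        using C1(2)[OF t] C1(1) True lam t by (intro mult_mono) auto
      then show ?thesis using C2(1) by simp
    next
      case False
      have "t powr r * exp (- (lam / 2) * t) = (1 / t) powr (- \<bar>r\<bar>) * exp (- (lam / 2) / (1 / t))"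
        using False t by (simp add: powr_minus powr_divide)
      also have "\<dots> \<le> C2" using C2(2)[of "1 / t"] t by simp
      finally have "(t powr r * exp (- (lam / 2) * t)) * exp (- (a\<^sup>2 / 4) / t) \<le> C2 * 1"
        using C2(1) t by (intro mult_mono) auto
      then show ?thesis using C1(1) by (simp add: mult_ac)
    qed
    then have "t powr r * exp (- (a\<^sup>2 / 4) / t) * exp (- (lam / 2) * t) * exp (- (lam / 2) * t) \<le> (C1 + C2) * exp (- (lam / 2) * t)"
      by (intro mult_right_mono) auto
    then show ?thesis unfolding e by (simp only: mult.assoc)
  qed
  show "set_integrable lborel {0<..} (\<lambda>t. t powr q * poisson_weight lam a t)"
    unfolding set_integrable_def
  proof (rule Bochner_Integration.integrable_bound)
    show "integrable lborel (\<lambda>t. indicator {0<..} t *\<^sub>R (c * (C1 + C2) * exp (- (lam / 2) * t)))"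
      using set_integrable_mult_right[OF set_integrable_exp[of "lam / 2"], of "c * (C1 + C2)"] lam
      unfolding set_integrable_def by auto
    show "(\<lambda>t. indicator {0<..} t *\<^sub>R (t powr q * poisson_weight lam a t)) \<in> borel_measurable lborel"
      unfolding poisson_weight_def by measurable
    show "AE t in lborel. norm (indicator {0<..} t *\<^sub>R (t powr q * poisson_weight lam a t))
        \<le> norm (indicator {0<..} t *\<^sub>R (c * (C1 + C2) * exp (- (lam / 2) * t)))"
    proof (rule AE_I2)
      fix t :: real
      show "norm (indicator {0<..} t *\<^sub>R (t powr q * poisson_weight lam a t))
        \<le> norm (indicator {0<..} t *\<^sub>R (c * (C1 + C2) * exp (- (lam / 2) * t)))"
      proof (cases "t > 0")
        case True
        then have "\<bar>t powr q * poisson_weight lam a t\<bar> \<le> c * ((C1 + C2) * exp (- (lam / 2) * t))"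
          using c bound unfolding eq[OF True] by (subst abs_of_nonneg) (auto intro!: mult_left_mono)
        then show ?thesis using True c C1(1) C2(1) by (simp add: abs_mult mult_ac)
      qed simp
    qed
  qed
qed

subsection \<open>Fourier transforms and the second moment\<close>

lemma
  fixes f :: "'a::euclidean_space \<Rightarrow> 'b::{banach, second_countable_topology}"
  assumes [measurable]: "f \<in> borel_measurable borel"
  shows integral_lborel_translate: "(LINT z|lborel. f (z - p)) = (LINT z|lborel. f z)"
    and integrable_lborel_translate: "integrable lborel (\<lambda>z. f (z - p)) \<longleftrightarrow> integrable lborel f"
proof -
  have d: "lborel = distr lborel borel (\<lambda>z. z - p)"
  proof -
    have "(\<lambda>z. z - p) = (+) (- p)" by auto
    then show ?thesis using lborel_distr_plus[of "- p"] by simp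
  qed
  have "(LINT z|lborel. f z) = (LINT z|distr lborel borel (\<lambda>z. z - p). f z)"
    by (rule arg_cong[OF d])
  also have "\<dots> = (LINT z|lborel. f (z - p))"
    by (simp add: integral_distr)
  finally show "(LINT z|lborel. f (z - p)) = (LINT z|lborel. f z)" ..
  have "integrable lborel f \<longleftrightarrow> integrable (distr lborel borel (\<lambda>z. z - p)) f"
    by (rule arg_cong[OF d])
  then show "integrable lborel (\<lambda>z. f (z - p)) \<longleftrightarrow> integrable lborel f"
    by (simp add: integrable_distr_eq)
qed

lemma
  fixes f :: "'a::euclidean_space \<Rightarrow> 'b::{banach, second_countable_topology}"
  assumes [measurable]: "f \<in> borel_measurable borel"
  shows integral_lborel_minus: "(LINT z|lborel. f (- z)) = (LINT z|lborel. f z)"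
    and integrable_lborel_minus: "integrable lborel (\<lambda>z. f (- z)) \<longleftrightarrow> integrable lborel f"
proof -
  have d: "lborel = distr lborel borel (uminus :: 'a \<Rightarrow> 'a)"
    using lborel_affine[of "-1" "0 :: 'a"] by (simp add: density_1)
  have "(LINT z|lborel. f z) = (LINT z|distr lborel borel uminus. f z)"
    by (rule arg_cong[OF d])
  also have "\<dots> = (LINT z|lborel. f (- z))"
    by (simp add: integral_distr)
  finally show "(LINT z|lborel. f (- z)) = (LINT z|lborel. f z)" ..
  have "integrable lborel f \<longleftrightarrow> integrable (distr lborel borel uminus) f"
    by (rule arg_cong[OF d])
  then show "integrable lborel (\<lambda>z. f (- z)) \<longleftrightarrow> integrable lborel f"
    by (simp add: integrable_distr_eq)
qed

lemma fourier_translate: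
  fixes f :: "'a::euclidean_space \<Rightarrow> complex"
  assumes [measurable]: "f \<in> borel_measurable borel"
  shows "fourier (\<lambda>z. f (z - p)) y = exp (\<i> * complex_of_real (p \<bullet> y)) * fourier f y"
proof -
  have "fourier (\<lambda>z. f (z - p)) y =
      (LINT z|lborel. exp (\<i> * complex_of_real (p \<bullet> y)) * (exp (\<i> * complex_of_real ((z - p) \<bullet> y)) * f (z - p)))"
    unfolding fourier_def
    by (intro Bochner_Integration.integral_cong refl)
      (simp add: exp_add[symmetric] inner_diff_left algebra_simps flip: mult.assoc)
  also have "\<dots> = (LINT z|lborel. exp (\<i> * complex_of_real (p \<bullet> y)) * (exp (\<i> * complex_of_real (z \<bullet> y)) * f z))"
    by (rule integral_lborel_translate) measurable
  finally show ?thesis by (simp add: fourier_def)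
qed

lemma
  fixes f :: "'a::euclidean_space \<Rightarrow> complex"
  assumes f: "integrable lborel f"
  shows integrable_conj_reflect: "integrable lborel (conj_reflect f)"
    and fourier_conj_reflect: "fourier (conj_reflect f) y = cnj (fourier f y)"
proof -
  have [measurable]: "f \<in> borel_measurable borel" using f by (auto dest: borel_measurable_integrable)
  have "integrable lborel (\<lambda>z. f (- z))" using f by (simp add: integrable_lborel_minus)
  then show "integrable lborel (conj_reflect f)"
    unfolding conj_reflect_def[abs_def] by (rule integrable_cnj)
  have "fourier (conj_reflect f) y = (LINT z|lborel. cnj (exp (\<i> * complex_of_real ((- z) \<bullet> y)) * f (- z)))"
    unfolding fourier_def conj_reflect_def by (simp add: exp_cnj)
  also have "\<dots> = (LINT z|lborel. cnj (exp (\<i> * complex_of_real (z \<bullet> y)) * f z))"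
  proof (rule integral_lborel_minus)
    have [measurable]: "cnj \<in> borel_measurable borel"
      by (intro borel_measurable_continuous_onI continuous_intros)
    show "(\<lambda>z. cnj (exp (\<i> * complex_of_real (z \<bullet> y)) * f z)) \<in> borel_measurable borel"
      by measurable
  qed
  also have "\<dots> = cnj (fourier f y)"
    unfolding fourier_def by (rule Bochner_Integration.integral_cnj)
  finally show "fourier (conj_reflect f) y = cnj (fourier f y)" .
qed

text \<open>Fubini for \<open>H\<close>; integrating its norm in \<open>x\<close> first gives |g z|
  times the L1 norm of \<open>f\<close>, which is integrable in \<open>z\<close>.\<close>

lemma fourier_convolution:
  fixes f g :: "'a::euclidean_space \<Rightarrow> complex"
  assumes f: "integrable lborel f" and g: "integrable lborel g"
  shows "fourier (convolution f g) y = fourier f y * fourier g y"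
proof -
  have [measurable]: "f \<in> borel_measurable borel" "g \<in> borel_measurable borel"
    using f g by (auto dest: borel_measurable_integrable)
  define H where "H z x = exp (\<i> * complex_of_real (x \<bullet> y)) * (f (x - z) * g z)" for z x
  have ft: "integrable lborel (\<lambda>x. f (x - z))" for z
    using f by (simp add: integrable_lborel_translate)
  have int: "integrable (lborel \<Otimes>\<^sub>M lborel) (\<lambda>(z, x). H z x)"
  proof (rule lborel_pair.Fubini_integrable)
    show "(\<lambda>(z, x). H z x) \<in> borel_measurable (lborel \<Otimes>\<^sub>M lborel)"
      unfolding H_def by measurable
    have "(LINT x|lborel. norm (H z x)) = norm (g z) * (LINT x|lborel. norm (f x))" for z
    proof -
      have "(LINT x|lborel. norm (H z x)) = (LINT x|lborel. norm (g z) * norm (f (x - z)))"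
        by (simp add: H_def norm_mult mult.commute)
      also have "\<dots> = norm (g z) * (LINT x|lborel. norm (f x))"
        using integral_lborel_translate[of "\<lambda>x. norm (f x)" z] by simp
      finally show ?thesis .
    qed
    then show "integrable lborel (\<lambda>z. LINT x|lborel. norm (case (z, x) of (z, x) \<Rightarrow> H z x))"
      using integrable_norm[OF g] by (simp add: integrable_mult_left)
    show "AE z in lborel. integrable lborel (\<lambda>x. case (z, x) of (z, x) \<Rightarrow> H z x)"
    proof (rule AE_I2)
      fix z
      have "integrable lborel (H z)"
      proof (rule Bochner_Integration.integrable_bound)
        show "integrable lborel (\<lambda>x. f (x - z) * g z)" using ft by (intro integrable_mult_left)
        show "H z \<in> borel_measurable lborel" unfolding H_def[abs_def] by measurable
      qed (simp add: H_def norm_mult)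
      then show "integrable lborel (\<lambda>x. case (z, x) of (z, x) \<Rightarrow> H z x)" by simp
    qed
  qed
  have "fourier (convolution f g) y = (LINT x|lborel. (LINT z|lborel. H z x))"
    unfolding fourier_def convolution_def H_def by (simp only: integral_mult_right_zero)
  also have "\<dots> = (LINT z|lborel. (LINT x|lborel. H z x))"
    by (rule lborel_pair.Fubini_integral[OF int])
  also have "\<dots> = (LINT z|lborel. fourier f y * (exp (\<i> * complex_of_real (z \<bullet> y)) * g z))"
  proof (rule Bochner_Integration.integral_cong[OF refl])
    fix z
    have "(LINT x|lborel. H z x) = fourier (\<lambda>x. f (x - z)) y * g z"
      unfolding H_def fourier_def mult.assoc[symmetric] by simp
    then show "(LINT x|lborel. H z x) = fourier f y * (exp (\<i> * complex_of_real (z \<bullet> y)) * g z)"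
      by (simp add: fourier_translate)
  qed
  also have "\<dots> = fourier f y * fourier g y"
    by (simp add: fourier_def)
  finally show ?thesis .
qed

text \<open>Fubini brings the Fourier transform inside the mixture, where each Gaussian contributes
  exp(-t |y|^2). The centre \<open>p\<close> enters as a phase and drops out of the norm.\<close>

lemma
  fixes p :: "'a::euclidean_space"
  assumes \<rho>: "rapid_weight \<rho>"
  shows integrable_heat_mixture: "integrable lborel (\<lambda>z. complex_of_real (heat_mixture \<rho> (z - p)))"
    and norm_fourier_heat_mixture:
      "norm (fourier (\<lambda>z. complex_of_real (heat_mixture \<rho> (z - p))) y) \<le> (LBINT t:{0<..}. \<bar>\<rho> t\<bar> * exp (- t * (norm y)\<^sup>2))"
proof -
  define r where "r t = indicator {0<..} t * \<rho> t" for t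
  have [measurable]: "r \<in> borel_measurable borel"
    unfolding r_def[abs_def] by (rule rapid_weight_measurable[OF \<rho>])
  have "r = (\<lambda>t. indicator {0<..} t *\<^sub>R (t powr 0 * \<rho> t))"
    by (auto simp: r_def indicator_def)
  then have r: "integrable lborel r"
    using rapid_weight_integrable[OF \<rho>, of 0] by (simp only: set_integrable_def)
  have mix: "heat_mixture \<rho> z = (LINT t|lborel. r t * heat_kernel t z)" for z :: 'a
    by (simp add: heat_mixture_def set_lebesgue_integral_def r_def mult.assoc)
  \<comment> \<open>One integrability statement for two uses: the constant \<open>c = 1\<close>
    shows that the mixture is integrable, the Fourier character justifies the exchange of
    integrals.\<close>
  have int: "integrable (lborel \<Otimes>\<^sub>M lborel) (\<lambda>(t, z). complex_of_real (r t * heat_kernel t z) * c z)"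
    if [measurable]: "c \<in> borel_measurable borel" and c: "\<And>z::'a. norm (c z) = 1" for c
  proof (rule lborel_pair.Fubini_integrable)
    show "(\<lambda>(t, z). complex_of_real (r t * heat_kernel t z) * c z) \<in> borel_measurable (lborel \<Otimes>\<^sub>M lborel)"
      by measurable
    have i: "integrable lborel (\<lambda>z::'a. r t * heat_kernel t z)" for t
      by (cases "t > 0") (auto simp: r_def intro!: integrable_mult_right integrable_heat_kernel)
    have "(LINT z|lborel. norm (complex_of_real (r t * heat_kernel t z) * c z)) = \<bar>r t\<bar>" for t
    proof -
      have "(LINT z|lborel. norm (complex_of_real (r t * heat_kernel t z) * c z)) = (LINT z::'a|lborel. \<bar>r t\<bar> * heat_kernel t z)"
        by (simp add: norm_mult c heat_kernel_nonneg abs_mult)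
      also have "\<dots> = \<bar>r t\<bar>"
        by (cases "t > 0") (simp_all add: integral_heat_kernel r_def)
      finally show ?thesis .
    qed
    then show "integrable lborel (\<lambda>t. LINT z|lborel. norm (case (t, z) of (t, z) \<Rightarrow> complex_of_real (r t * heat_kernel t z) * c z))"
      using integrable_abs[OF r] by simp
    show "AE t in lborel. integrable lborel (\<lambda>z. case (t, z) of (t, z) \<Rightarrow> complex_of_real (r t * heat_kernel t z) * c z)"
    proof (rule AE_I2)
      fix t
      have "integrable lborel (\<lambda>z. complex_of_real (r t * heat_kernel t z) * c z)"
        by (rule Bochner_Integration.integrable_bound[OF i[of t]]) (auto simp: norm_mult c)
      then show "integrable lborel (\<lambda>z. case (t, z) of (t, z) \<Rightarrow> complex_of_real (r t * heat_kernel t z) * c z)"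
        by simp
    qed
  qed
  define F where "F z = complex_of_real (heat_mixture \<rho> z)" for z :: 'a
  have Fc: "(LINT t|lborel. complex_of_real (r t * heat_kernel t z) * c z) = F z * c z" for c and z :: 'a
    by (simp only: integral_mult_left_zero integral_complex_of_real F_def mix)
  have "integrable (lborel \<Otimes>\<^sub>M lborel) (\<lambda>(t, z::'a). complex_of_real (r t * heat_kernel t z) * 1)"
    by (rule int) auto
  from lborel_pair.integrable_snd[OF this] have "integrable lborel (\<lambda>z. F z * 1)"
    by (simp only: Fc[where c = "\<lambda>_. 1"])
  then have F: "integrable lborel F" by simp
  then have [measurable]: "F \<in> borel_measurable borel" by (auto dest: borel_measurable_integrable)
  show "integrable lborel (\<lambda>z. complex_of_real (heat_mixture \<rho> (z - p)))"
    using F integrable_lborel_translate[of F p] by (simp add: F_def)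
  have "fourier F y = (LINT z|lborel. (LINT t|lborel. complex_of_real (r t * heat_kernel t z) * exp (\<i> * complex_of_real (z \<bullet> y))))"
    unfolding Fc[where c = "\<lambda>z. exp (\<i> * complex_of_real (z \<bullet> y))"] by (simp add: fourier_def mult.commute)
  also have "\<dots> = (LINT t|lborel. (LINT z|lborel. complex_of_real (r t * heat_kernel t z) * exp (\<i> * complex_of_real (z \<bullet> y))))"
    by (rule lborel_pair.Fubini_integral[OF int]) auto
  also have "\<dots> = (LINT t|lborel. complex_of_real (r t * exp (- t * (norm y)\<^sup>2)))"
  proof (rule Bochner_Integration.integral_cong[OF refl])
    fix t
    have "(LINT z|lborel. complex_of_real (r t * heat_kernel t z) * exp (\<i> * complex_of_real (z \<bullet> y))) =
        complex_of_real (r t) * fourier (\<lambda>z. complex_of_real (heat_kernel t z)) y"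
      by (simp add: fourier_def mult_ac)
    also have "\<dots> = complex_of_real (r t * exp (- t * (norm y)\<^sup>2))"
      by (cases "t > 0") (simp_all add: fourier_heat_kernel r_def exp_of_real[symmetric])
    finally show "(LINT z|lborel. complex_of_real (r t * heat_kernel t z) * exp (\<i> * complex_of_real (z \<bullet> y))) =
        complex_of_real (r t * exp (- t * (norm y)\<^sup>2))" .
  qed
  finally have "norm (fourier F y) \<le> (LINT t|lborel. norm (complex_of_real (r t * exp (- t * (norm y)\<^sup>2))))"
    by (simp only: integral_norm_bound)
  also have "\<dots> = (LBINT t:{0<..}. \<bar>\<rho> t\<bar> * exp (- t * (norm y)\<^sup>2))"
    unfolding set_lebesgue_integral_def
    by (intro Bochner_Integration.integral_cong refl) (auto simp: r_def indicator_def abs_mult norm_mult)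
  finally have "norm (fourier F y) \<le> (LBINT t:{0<..}. \<bar>\<rho> t\<bar> * exp (- t * (norm y)\<^sup>2))" .
  moreover have "norm (fourier (\<lambda>z. F (z - p)) y) = norm (fourier F y)"
    by (simp add: fourier_translate norm_mult)
  ultimately show "norm (fourier (\<lambda>z. complex_of_real (heat_mixture \<rho> (z - p))) y) \<le> (LBINT t:{0<..}. \<bar>\<rho> t\<bar> * exp (- t * (norm y)\<^sup>2))"
    by (simp add: F_def)
qed

section \<open>Bounds for the weight and for the Fourier transform of the boundary kernel\<close>

lemma poisson_weight_nonneg: "0 \<le> a \<Longrightarrow> 0 < t \<Longrightarrow> 0 \<le> poisson_weight lam a t"
  by (simp add: poisson_weight_def heat_kernel_nonneg)

lemma heat_kernel_real_le:
  fixes a t :: real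
  assumes "t > 0"
  shows "heat_kernel t a \<le> t powr (- (1 / 2)) * exp (- a\<^sup>2 / (4 * t))"
proof -
  have "(4 * pi * t) powr (- (1 / 2)) \<le> t powr (- (1 / 2))"
    using assms pi_gt3 by (intro powr_mono2') auto
  then show ?thesis by (simp add: heat_kernel_def mult_right_mono)
qed

text \<open>With u = a^2/(4t) the factor a/t equals (4/a) u, and u exp(-u) <= 1 absorbs u; this is
  the origin of 4/a. The exponent is written \<open>1 / 2 - 1\<close> to fit the Gamma
  integral.\<close>

lemma poisson_weight_le_inverse:
  assumes a: "a > 0" and t: "t > 0"
  shows "poisson_weight lam a t \<le> 4 / a * (t powr (1 / 2 - 1) * exp (- lam * t))"
proof -
  define u where "u = a\<^sup>2 / (4 * t)"
  have u: "u > 0" using a t by (simp add: u_def)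
  have "u * exp (- u) \<le> 1"
    using power_le_fact_exp[of u 1] u by (simp add: exp_minus field_simps)
  then have "4 / a * (u * exp (- u)) \<le> 4 / a * 1" using a by (intro mult_left_mono) auto
  moreover have "a / t = 4 / a * u" using a t by (simp add: u_def power2_eq_square)
  ultimately have 1: "a / t * exp (- u) \<le> 4 / a" by simp
  have "poisson_weight lam a t \<le> exp (- lam * t) * (a / t) * (t powr (- (1 / 2)) * exp (- u))"
    unfolding poisson_weight_def using heat_kernel_real_le[OF t, of a] a t
    by (intro mult_left_mono) (auto simp: u_def)
  also have "\<dots> = (a / t * exp (- u)) * (t powr (1 / 2 - 1) * exp (- lam * t))" by simp
  also have "\<dots> \<le> 4 / a * (t powr (1 / 2 - 1) * exp (- lam * t))"
    using 1 by (intro mult_right_mono) auto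
  finally show ?thesis .
qed

text \<open>Parabolic scaling: a^3 t^(-3/2) exp(-a^2/(4t)) depends on t/a^2 alone, so one constant
  bounds it for all \<open>a\<close>.\<close>

lemma poisson_weight_le_inverse_square:
  obtains C where "C > 0"
    "\<And>lam a t. a > 0 \<Longrightarrow> t > 0 \<Longrightarrow> poisson_weight lam a t \<le> C / a\<^sup>2 * exp (- lam * t)"
proof -
  have "(1 / 4 :: real) > 0" "(3 / 2 :: real) \<ge> 0" by simp_all
  from powr_exp_inverse_bounded[OF this]
  obtain C where C: "C > 0" "\<And>t::real. t > 0 \<Longrightarrow> t powr (- (3 / 2)) * exp (- (1 / 4) / t) \<le> C"
    by blast
  show thesis
  proof (rule that[OF C(1)])
    fix lam a t :: real
    assume a: "a > 0" and t: "t > 0"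
    have "(a powr 2) powr (3 / 2) = a powr 3" unfolding powr_powr by simp
    then have "(a\<^sup>2) powr (3 / 2) = a ^ 3" using a by (simp add: powr_numeral)
    then have "(a\<^sup>2) powr (- (3 / 2)) = 1 / a ^ 3" by (simp only: powr_minus_divide)
    moreover have "(t / a\<^sup>2) powr (- (3 / 2)) = t powr (- (3 / 2)) / (a\<^sup>2) powr (- (3 / 2))"
      by (rule powr_divide)
    ultimately have "(t / a\<^sup>2) powr (- (3 / 2)) = a ^ 3 * t powr (- (3 / 2))" by simp
    moreover have "- (1 / 4) / (t / a\<^sup>2) = - a\<^sup>2 / (4 * t)" using a t by simp
    ultimately have "a ^ 3 * t powr (- (3 / 2)) * exp (- a\<^sup>2 / (4 * t)) \<le> C"
      using C(2)[of "t / a\<^sup>2"] a t by simp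
    then have 1: "a * t powr (- (3 / 2)) * exp (- a\<^sup>2 / (4 * t)) \<le> C / a\<^sup>2"
      using a by (simp add: field_simps power2_eq_square power3_eq_cube)
    have "t powr (- (3 / 2)) = t powr (- 1 + - (1 / 2))" by simp
    also have "\<dots> = t powr (- 1) * t powr (- (1 / 2))" by (rule powr_add)
    finally have 2: "t powr (- (3 / 2)) = 1 / t * t powr (- (1 / 2))" using t by (simp add: powr_minus_divide)
    have "poisson_weight lam a t \<le> exp (- lam * t) * (a / t) * (t powr (- (1 / 2)) * exp (- a\<^sup>2 / (4 * t)))"
      unfolding poisson_weight_def using heat_kernel_real_le[OF t, of a] a t
      by (intro mult_left_mono) auto
    also have "\<dots> = (a * t powr (- (3 / 2)) * exp (- a\<^sup>2 / (4 * t))) * exp (- lam * t)"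
      unfolding 2 by simp
    also have "\<dots> \<le> C / a\<^sup>2 * exp (- lam * t)"
      using 1 by (intro mult_right_mono) auto
    finally show "poisson_weight lam a t \<le> C / a\<^sup>2 * exp (- lam * t)" .
  qed
qed

text \<open>Each bound discards one of two exponentials. Dropping exp(-t |y|^2) leaves the integral
  of t^(-1/2) e^(-lam t), finite because \<open>lam > 0\<close>; dropping e^(-lam t) leaves the
  integral of exp(-t |y|^2), equal to 1/|y|^2. The constant depends on \<open>lam\<close>, but not
  on \<open>a\<close>, \<open>p\<close> or \<open>y\<close>.\<close>

lemma norm_fourier_poisson_kernel:
  assumes lam: "lam > 0"
  obtains C where "C > 0"
    "\<And>a (p :: 'a::euclidean_space) y. a > 0 \<Longrightarrow>
      norm (fourier (\<lambda>z. complex_of_real (heat_mixture (poisson_weight lam a) (z - p))) y) \<le> C / a"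
    "\<And>a (p :: 'a::euclidean_space) y. a > 0 \<Longrightarrow> y \<noteq> 0 \<Longrightarrow>
      norm (fourier (\<lambda>z. complex_of_real (heat_mixture (poisson_weight lam a) (z - p))) y) \<le> C / (a\<^sup>2 * (norm y)\<^sup>2)"
proof -
  obtain C where C: "C > 0"
    "\<And>a t. a > 0 \<Longrightarrow> t > 0 \<Longrightarrow> poisson_weight lam a t \<le> C / a\<^sup>2 * exp (- lam * t)"
    using poisson_weight_le_inverse_square by metis
  define J where "J = (LBINT t:{0<..}. t powr (1 / 2 - 1) * exp (- lam * t))"
  have J: "J \<ge> 0"
    unfolding J_def set_lebesgue_integral_def by (intro Bochner_Integration.integral_nonneg) auto
  let ?D = "4 * J + C"
  note est = norm_fourier_heat_mixture[OF rapid_weight_poisson_weight[OF lam]]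
  show thesis
  proof (rule that)
    show "?D > 0" using C(1) J by simp
    fix a :: real and p y :: 'a
    assume a: "a > 0"
    note est[OF a, of p y]
    also have "(LBINT t:{0<..}. \<bar>poisson_weight lam a t\<bar> * exp (- t * (norm y)\<^sup>2))
        \<le> (LBINT t:{0<..}. 4 / a * (t powr (1 / 2 - 1) * exp (- lam * t)))"
      unfolding set_lebesgue_integral_def
    proof (rule integral_mono')
      show "integrable lborel (\<lambda>t. indicator {0<..} t *\<^sub>R (4 / a * (t powr (1 / 2 - 1) * exp (- lam * t))))"
        using set_integrable_mult_right[OF set_integrable_powr_exp[of "1 / 2" lam], of "4 / a"] lam
        unfolding set_integrable_def by simp
      fix t :: real
      show "indicator {0<..} t *\<^sub>R (\<bar>poisson_weight lam a t\<bar> * exp (- t * (norm y)\<^sup>2))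
          \<le> indicator {0<..} t *\<^sub>R (4 / a * (t powr (1 / 2 - 1) * exp (- lam * t)))"
      proof (cases "t > 0")
        case True
        have "\<bar>poisson_weight lam a t\<bar> * exp (- t * (norm y)\<^sup>2) \<le> \<bar>poisson_weight lam a t\<bar> * 1"
          using True by (intro mult_left_mono) auto
        then show ?thesis
          using poisson_weight_le_inverse[OF a True, of lam] poisson_weight_nonneg[of a t lam] a True by simp
      qed simp
    qed (use a in auto)
    also have "\<dots> = 4 * J / a"
      unfolding J_def by (subst set_integral_mult_right) simp
    also have "\<dots> \<le> ?D / a" using C(1) a by (intro divide_right_mono) auto
    finally show "norm (fourier (\<lambda>z. complex_of_real (heat_mixture (poisson_weight lam a) (z - p))) y) \<le> ?D / a" .
  next
    fix a :: real and p y :: 'a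
    assume a: "a > 0" and "y \<noteq> 0"
    then have y: "(norm y)\<^sup>2 > 0" by simp
    note est[OF a, of p y]
    also have "(LBINT t:{0<..}. \<bar>poisson_weight lam a t\<bar> * exp (- t * (norm y)\<^sup>2))
        \<le> (LBINT t:{0<..}. C / a\<^sup>2 * exp (- (norm y)\<^sup>2 * t))"
      unfolding set_lebesgue_integral_def
    proof (rule integral_mono')
      show "integrable lborel (\<lambda>t. indicator {0<..} t *\<^sub>R (C / a\<^sup>2 * exp (- (norm y)\<^sup>2 * t)))"
        using set_integrable_mult_right[OF set_integrable_exp[OF y], of "C / a\<^sup>2"]
        unfolding set_integrable_def by simp
      fix t :: real
      show "indicator {0<..} t *\<^sub>R (\<bar>poisson_weight lam a t\<bar> * exp (- t * (norm y)\<^sup>2))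
          \<le> indicator {0<..} t *\<^sub>R (C / a\<^sup>2 * exp (- (norm y)\<^sup>2 * t))"
      proof (cases "t > 0")
        case True
        have "\<bar>poisson_weight lam a t\<bar> \<le> C / a\<^sup>2 * exp (- lam * t)"
          using C(2)[OF a True] poisson_weight_nonneg[of a t lam] a True by simp
        also have "\<dots> \<le> C / a\<^sup>2 * 1"
          using C(1) lam True by (intro mult_left_mono) auto
        finally have "\<bar>poisson_weight lam a t\<bar> * exp (- t * (norm y)\<^sup>2) \<le> C / a\<^sup>2 * exp (- t * (norm y)\<^sup>2)"
          by (intro mult_right_mono) auto
        then show ?thesis using True by (simp add: mult.commute)
      qed simp
    qed (use C(1) in auto)
    also have "\<dots> = C / a\<^sup>2 * (1 / (norm y)\<^sup>2)"
      unfolding set_integral_exp[OF y, symmetric] by (rule set_integral_mult_right)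
    also have "\<dots> \<le> ?D / (a\<^sup>2 * (norm y)\<^sup>2)"
      using J a y by (simp add: divide_right_mono)
    finally show "norm (fourier (\<lambda>z. complex_of_real (heat_mixture (poisson_weight lam a) (z - p))) y) \<le> ?D / (a\<^sup>2 * (norm y)\<^sup>2)" .
  qed
qed

text \<open>The covariance identity is stated with a Bochner expectation, which by itself says
  nothing about integrability. Gaussianity supplies it, the degenerate law being a point
  mass.\<close>

lemma integrable_square_normal_law:
  assumes X: "X \<in> borel_measurable M" and d: "distr M borel X = normal_law \<mu> v" and v: "v \<ge> 0"
  shows "integrable M (\<lambda>\<omega>. (X \<omega>)\<^sup>2)"
proof -
  have "integrable (normal_law \<mu> v) (\<lambda>x. x\<^sup>2)"
  proof (cases "v = 0")
    case True
    then show ?thesis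
      unfolding normal_law_def by (simp add: integrable_iff_bounded nn_integral_return)
  next
    case False
    then have s: "sqrt v > 0" using v by simp
    \<comment> \<open>The mean is arbitrary, so \<open>x\<^sup>2\<close> is compared with the
      centred second moment.\<close>
    have "integrable lborel (\<lambda>x. normal_density \<mu> (sqrt v) x * x\<^sup>2)"
    proof (rule Bochner_Integration.integrable_bound)
      show "integrable lborel (\<lambda>x. 2 * (normal_density \<mu> (sqrt v) x * (x - \<mu>) ^ (2 * 1)) + 2 * \<mu>\<^sup>2 * normal_density \<mu> (sqrt v) x)"
        using normal_moment_even[OF s, of \<mu> 1] integrable_normal_density[OF s, of \<mu>]
        by (intro Bochner_Integration.integrable_add integrable_mult_right) (auto simp: has_bochner_integral_iff)
      show "AE x in lborel. norm (normal_density \<mu> (sqrt v) x * x\<^sup>2)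
        \<le> norm (2 * (normal_density \<mu> (sqrt v) x * (x - \<mu>) ^ (2 * 1)) + 2 * \<mu>\<^sup>2 * normal_density \<mu> (sqrt v) x)"
      proof (rule AE_I2)
        fix x :: real
        have "x\<^sup>2 \<le> 2 * (x - \<mu>)\<^sup>2 + 2 * \<mu>\<^sup>2"
          using zero_le_power2[of "x - 2 * \<mu>"] by (simp add: power2_eq_square algebra_simps)
        then have "normal_density \<mu> (sqrt v) x * x\<^sup>2 \<le> normal_density \<mu> (sqrt v) x * (2 * (x - \<mu>)\<^sup>2 + 2 * \<mu>\<^sup>2)"
          by (intro mult_left_mono) auto
        also have "\<dots> = 2 * (normal_density \<mu> (sqrt v) x * (x - \<mu>) ^ (2 * 1)) + 2 * \<mu>\<^sup>2 * normal_density \<mu> (sqrt v) x"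
          by (simp add: distrib_left mult_ac)
        finally show "norm (normal_density \<mu> (sqrt v) x * x\<^sup>2)
        \<le> norm (2 * (normal_density \<mu> (sqrt v) x * (x - \<mu>) ^ (2 * 1)) + 2 * \<mu>\<^sup>2 * normal_density \<mu> (sqrt v) x)"
          by (auto intro: order_trans[OF _ abs_ge_self])
      qed
    qed measurable
    then show ?thesis
      using False unfolding normal_law_def by (simp add: integrable_density)
  qed
  then have "integrable (distr M borel X) (\<lambda>x. x\<^sup>2)" unfolding d .
  then show ?thesis using X by (simp add: integrable_distr_eq)
qed

text \<open>A non-integrable \<open>f\<close> has Bochner integral 0, so the inequality holds also
  when the right-hand side is infinite.\<close>

lemma ennreal_integral_le_nn_integral:
  assumes "\<And>x. 0 \<le> f x"
  shows "ennreal (integral\<^sup>L M f) \<le> (\<integral>\<^sup>+x. ennreal (f x) \<partial>M)"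
  using assms by (cases "integrable M f") (auto simp: nn_integral_eq_integral not_integrable_integral_eq)

text \<open>The spectral identity on the diagonal: convolving \<open>\<psi>\<close> with its
  reflected conjugate turns the Fourier transform into its squared modulus. The conclusion is an
  inequality because the spectral integral in the hypothesis is a Bochner integral, while the
  right-hand side here may be infinite.\<close>

lemma second_moment_le_spectral:
  assumes W: "homogeneous_wiener_process M W Q" and Q: "spectral_measure Q \<nu>"
    and \<psi>: "\<psi> \<in> schwartz" and int: "integrable lborel (\<lambda>z. complex_of_real (\<psi> z))"
  shows "(\<integral>\<^sup>+\<omega>. ennreal ((W 1 \<omega> \<psi>)\<^sup>2) \<partial>M) \<le>
    (\<integral>\<^sup>+y. ennreal ((norm (fourier (\<lambda>z. complex_of_real (\<psi> z)) y))\<^sup>2) \<partial>\<nu>)"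
proof -
  have gauss: "gaussian_process M ({0..} \<times> schwartz) (\<lambda>(t, \<psi>) \<omega>. W t \<omega> \<psi>)"
    and cov: "\<forall>\<psi>\<in>schwartz. \<forall>\<phi>\<in>schwartz. \<forall>t\<ge>0. \<forall>s\<ge>0.
        prob_space.expectation M (\<lambda>\<omega>. W t \<omega> \<psi> * W s \<omega> \<phi>) = min t s * Q \<psi> \<phi>"
    using W unfolding homogeneous_wiener_process_def by blast+
  have meas: "(\<lambda>\<omega>. W 1 \<omega> \<psi>) \<in> borel_measurable M"
    using gauss \<psi> unfolding gaussian_process_def by (auto dest!: bspec[of _ _ "(1, \<psi>)"])
  \<comment> \<open>A one-element family in the Gaussian process yields the law of the single
    variable \<open>W 1 \<omega> \<psi>\<close>.\<close>
  have "\<exists>\<mu> v. v \<ge> 0 \<and> distr M borel (\<lambda>\<omega>. \<Sum>i\<in>{(1, \<psi>)}. 1 * (case i of (t, \<psi>) \<Rightarrow> \<lambda>\<omega>. W t \<omega> \<psi>) \<omega>) = normal_law \<mu> v"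
    using gauss \<psi> unfolding gaussian_process_def by (elim conjE allE[of _ "{(1, \<psi>)}"] allE[of _ "\<lambda>_. 1"]) simp
  then obtain \<mu> v where "v \<ge> 0" "distr M borel (\<lambda>\<omega>. W 1 \<omega> \<psi>) = normal_law \<mu> v" by auto
  then have i: "integrable M (\<lambda>\<omega>. (W 1 \<omega> \<psi>)\<^sup>2)"
    using integrable_square_normal_law[OF meas] by blast
  have "(LINT \<omega>|M. (W 1 \<omega> \<psi>)\<^sup>2) = Q \<psi> \<psi>"
    using cov[rule_format, OF \<psi> \<psi>, of 1 1] by (simp add: power2_eq_square)
  then have E: "(\<integral>\<^sup>+\<omega>. ennreal ((W 1 \<omega> \<psi>)\<^sup>2) \<partial>M) = ennreal (Q \<psi> \<psi>)"
    using i by (simp add: nn_integral_eq_integral)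
  define F where "F = (\<lambda>z. complex_of_real (\<psi> z))"
  have "complex_of_real (Q \<psi> \<psi>) = (LINT y|\<nu>. fourier (convolution F (conj_reflect F)) y)"
    using Q \<psi> unfolding spectral_measure_def fourier_distribution_def measure_distribution_def F_def by blast
  also have "\<dots> = (LINT y|\<nu>. complex_of_real ((norm (fourier F y))\<^sup>2))"
  proof -
    have F: "integrable lborel F" using int unfolding F_def .
    have "fourier (convolution F (conj_reflect F)) y = complex_of_real ((norm (fourier F y))\<^sup>2)" for y
      unfolding complex_norm_square
      by (simp only: fourier_convolution[OF F integrable_conj_reflect[OF F]] fourier_conj_reflect[OF F])
    then show ?thesis by (simp only:)
  qed
  also have "\<dots> = complex_of_real (LINT y|\<nu>. (norm (fourier F y))\<^sup>2)"
    by (rule integral_complex_of_real)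
  finally have "Q \<psi> \<psi> = (LINT y|\<nu>. (norm (fourier F y))\<^sup>2)"
    by (simp only: of_real_eq_iff)
  then show ?thesis
    unfolding E F_def using ennreal_integral_le_nn_integral[of "\<lambda>y. (norm (fourier (\<lambda>z. complex_of_real (\<psi> z)) y))\<^sup>2" \<nu>]
    by simp
qed

theorem proposition6:
  fixes lam :: real
    and M :: "'w measure"
    and W :: "real \<Rightarrow> 'w \<Rightarrow> (real ^ 'm \<Rightarrow> real) \<Rightarrow> real"
    and Q :: "(real ^ 'm \<Rightarrow> real) \<Rightarrow> (real ^ 'm \<Rightarrow> real) \<Rightarrow> real"
    and \<nu> :: "(real ^ 'm) measure"
    and G :: "real \<Rightarrow> real \<times> (real ^ 'm) \<Rightarrow> real \<times> (real ^ 'm) \<Rightarrow> real"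
    and u :: "real \<times> (real ^ 'm) \<Rightarrow> 'w \<Rightarrow> real"
  assumes "lam > 0"
    and "homogeneous_wiener_process M W Q"
    and "spectral_measure Q \<nu>"
    and "dirichlet_heat_kernel half_space G"
    and "\<And>x \<omega>. x \<in> half_space \<Longrightarrow> \<omega> \<in> space M \<Longrightarrow> u x \<omega> = dirichlet_solution lam G (W 1 \<omega>) x"
  shows "\<exists>C::real. \<forall>x\<in>half_space.
    (\<integral>\<^sup>+\<omega>. ennreal ((u x \<omega>)\<^sup>2) \<partial>M) \<le>
    ennreal C * (\<integral>\<^sup>+y. ennreal (
        fst x powr (-2) * indicator {y. norm y \<le> 1} y +
        fst x powr (-4) * norm y powr (- 1 / real CARD('m)) * indicator {y. norm y > 1} y) \<partial>\<nu>)"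
proof -
  obtain C where C: "C > 0"
    "\<And>a (p :: real ^ 'm) y. a > 0 \<Longrightarrow>
      norm (fourier (\<lambda>z. complex_of_real (heat_mixture (poisson_weight lam a) (z - p))) y) \<le> C / a"
    "\<And>a (p :: real ^ 'm) y. a > 0 \<Longrightarrow> y \<noteq> 0 \<Longrightarrow>
      norm (fourier (\<lambda>z. complex_of_real (heat_mixture (poisson_weight lam a) (z - p))) y) \<le> C / (a\<^sup>2 * (norm y)\<^sup>2)"
    using norm_fourier_poisson_kernel[OF assms(1)] by metis
  show ?thesis
  \<comment> \<open>The pointwise Fourier bounds hold with \<open>C\<close> and enter the second
    moment squared.\<close>
  proof (intro exI[of _ "C\<^sup>2"] ballI)
    fix x :: "real \<times> (real ^ 'm)"
    assume x: "x \<in> half_space"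
    then have a: "fst x > 0" by (auto simp: half_space_def)
    define P where "P = (\<lambda>z. heat_mixture (poisson_weight lam (fst x)) (z - snd x))"
    note rapid = rapid_weight_poisson_weight[OF assms(1) a]
    have P: "P \<in> schwartz"
      unfolding P_def by (rule polynomial_mixtures_schwartz[OF polynomial_mixtures.mixture[OF rapid]])
    have intP: "integrable lborel (\<lambda>z. complex_of_real (P z))"
      unfolding P_def by (rule integrable_heat_mixture[OF rapid])
    define g where "g y = fst x powr (-2) * indicator {y. norm y \<le> 1} y +
        fst x powr (-4) * norm y powr (- 1 / real CARD('m)) * indicator {y. norm y > 1} y" for y :: "real ^ 'm"
    have p2: "fst x powr (-2) = 1 / (fst x)\<^sup>2" and p4: "fst x powr (-4) = 1 / (fst x) ^ 4"
      using a by (simp_all add: powr_minus_divide powr_numeral)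
    have bound: "(norm (fourier (\<lambda>z. complex_of_real (P z)) y))\<^sup>2 \<le> C\<^sup>2 * g y" for y
    proof (cases "norm y \<le> 1")
      case True
      have "(norm (fourier (\<lambda>z. complex_of_real (P z)) y))\<^sup>2 \<le> (C / fst x)\<^sup>2"
        unfolding P_def by (intro power_mono C(2) a) simp
      also have "\<dots> = C\<^sup>2 * g y" using True by (simp add: g_def p2 power_divide)
      finally show ?thesis .
    next
      case False
      then have "y \<noteq> 0" by auto
      then have "(norm (fourier (\<lambda>z. complex_of_real (P z)) y))\<^sup>2 \<le> (C / ((fst x)\<^sup>2 * (norm y)\<^sup>2))\<^sup>2"
        unfolding P_def by (intro power_mono C(3) a) auto
      also have "\<dots> = C\<^sup>2 * (1 / (fst x) ^ 4 * norm y powr (- 4))"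
        using False by (simp add: power_divide power_mult_distrib powr_minus_divide powr_numeral)
      \<comment> \<open>Here \<open>norm y > 1\<close>, so the power increases with its exponent,
        and -4 <= -1/m because m >= 1.\<close>
      also have "\<dots> \<le> C\<^sup>2 * (1 / (fst x) ^ 4 * norm y powr (- 1 / real CARD('m)))"
      proof -
        have "1 \<le> real CARD('m)" by (simp add: Suc_le_eq)
        then have "1 \<le> real CARD('m) * 4" by linarith
        then have "- 4 \<le> - 1 / real CARD('m)" by (simp add: field_simps)
        then show ?thesis using False by (intro mult_left_mono powr_mono) auto
      qed
      also have "\<dots> = C\<^sup>2 * g y" using False by (simp add: g_def p4)
      finally show ?thesis .
    qed
    have g: "g \<in> borel_measurable \<nu>"
    proof -
      have "sets \<nu> = sets borel"
        using assms(3) by (simp add: spectral_measure_def tempered_measure_def)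
      moreover have "g \<in> borel_measurable borel" unfolding g_def by measurable
      ultimately show ?thesis using measurable_cong_sets by blast
    qed
    have "(\<integral>\<^sup>+\<omega>. ennreal ((u x \<omega>)\<^sup>2) \<partial>M) = (\<integral>\<^sup>+\<omega>. ennreal ((W 1 \<omega> P)\<^sup>2) \<partial>M)"
      using assms(5)[OF x] boundary_kernel_eq[OF assms(1,4) x]
      by (intro nn_integral_cong) (simp add: dirichlet_solution_def P_def)
    also have "\<dots> \<le> (\<integral>\<^sup>+y. ennreal ((norm (fourier (\<lambda>z. complex_of_real (P z)) y))\<^sup>2) \<partial>\<nu>)"
      by (rule second_moment_le_spectral[OF assms(2,3) P intP])
    also have "\<dots> \<le> (\<integral>\<^sup>+y. ennreal (C\<^sup>2) * ennreal (g y) \<partial>\<nu>)"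
      using bound by (intro nn_integral_mono) (simp add: ennreal_mult'[symmetric] ennreal_leI)
    also have "\<dots> = ennreal (C\<^sup>2) * (\<integral>\<^sup>+y. ennreal (g y) \<partial>\<nu>)"
      using g by (intro nn_integral_cmult) measurable
    finally show "(\<integral>\<^sup>+\<omega>. ennreal ((u x \<omega>)\<^sup>2) \<partial>M) \<le>
      ennreal (C\<^sup>2) * (\<integral>\<^sup>+y. ennreal (
        fst x powr (-2) * indicator {y. norm y \<le> 1} y +
        fst x powr (-4) * norm y powr (- 1 / real CARD('m)) * indicator {y. norm y > 1} y) \<partial>\<nu>)"
      unfolding g_def .
  qed
qed

end
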